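(* Let $A\in\mathcal{A}_{n,1}$, $(N,E)=\Lambda(A)$, let $(k;a_1,\dots,a_n;b,\beta)$ be the generalized inversion table of $(N,E)$ and $\Omega=(\omega_1,\dots,\omega_n)=\Phi(N,E)$. Then: (1) $r(A)=r(N)=a_n$, which equals the number of $E$-steps of $\Omega$ lying at height $n$ (i.e. both endpoints have $y$-coordinate $n$); all of them belong to $\omega_n$; (2) $i(A)=i(N)=a_1+\dots+a_n+b+1$, which equals the total number of $E$-steps and $N$-steps of $\Omega$; (3) $E(A)=E=a_{k-1}+\beta+1-a_k$, which equals the $x$-coordinate of the end vertex of the unique $N$-step of $\Omega$ minus the $x$-coordinate of the start vertex of the unique $S$-step of $\Omega$ (both vertices lie at height $k$); (4) $B(A)=B(N)-E=b-\beta$; (5) $J(A)=J(N)=a_k-a_{k-1}+b$, which equals the distance between the junctions of $\omega_{k-1}$ and $\omega_k$ (both at height $k-1$).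
   Context: An alternating sign matrix (ASM) of order $n$ is an $n\times n$ matrix $A=(a_{ij})$ with entries in $\{-1,0,1\}$ such that in every row and every column the nonzero entries alternate in sign, the first and the last nonzero entries being $1$. $\mathcal{A}_{n,s}$ denotes the set of order-$n$ ASMs having exactly $s$ entries equal to $-1$ (so $\mathcal{A}_{n,0}$ is the set of $n\times n$ permutation matrices). For an ASM $A=(a_{ij})$: $r(A)$ is the number of entries of the first row lying to the left of its unique nonzero entry (which is a $1$); $i(A)=\sum a_{ij}a_{k\ell}$, the sum over all pairs of positions with $k>i$ and $\ell<j$ (number of inversions); $\overline{A}=(a_{i,n+1-j})$ is the vertical reflection of $A$. Let $A\in\mathcal{A}_{n,1}$. The opening column is the column containing the unique $-1$; the closing row is the row containing the $-1$; the opening row is the row of the $1$ of the opening column lying above the $-1$. The columns strictly to the left (resp. right) of the opening column form the left side (resp. right side). The closing row contains exactly two $1$'s, one in each side; the one in the right side is the closing $1$ and its column is the closing column. The rows strictly between the opening row and the closing row are the enclosed rows. $A$ is neutral if there are no enclosed rows; otherwise $A$ is positive if the $1$ of the lowest enclosed row lies in the right side, and negative if it lies in the left side. $\mathcal{A}_{n,1}^{+},\mathcal{A}_{n,1}^{0},\mathcal{A}_{n,1}^{-}$ denote the sets of positive, neutral, negative elements of $\mathcal{A}_{n,1}$; $A$ is negative iff $\overline{A}$ is positive. For $A\in\mathcal{A}_{n,1}^{+}\cup\mathcal{A}_{n,1}^{0}$: the charged cell is the intersection of the enclosed rows with the right side; the extended neutral cell is the intersection of the rows from the opening row to the closing row (inclusive)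 with the left side. The leading $1$ is the highest $1$ in the left side strictly below the opening row; its column is the leading column; the leading cell consists of the entries strictly below the opening row and strictly between the leading column and the opening column, and $\ell(A)$ is the sum of its entries. The closing cell consists of the entries strictly below the closing row and strictly between the opening column and the closing column, and $c(A)$ is the sum of its entries; the extended closing cell consists of the entries strictly below the closing row in the columns from the opening column to the closing column inclusive. Parameters: if $A$ is positive, $E(A)$ is the sum of the entries of the charged cell; if $A$ is neutral, $E(A)=0$; if $A$ is negative, $E(A)=-E(\overline{A})$. For $A\in\mathcal{A}_{n,1}^{+}\cup\mathcal{A}_{n,1}^{0}$, $B(A)=c(A)-\ell(A)$ and $J(A)=c(A)+\ell(A)+|E(A)|+1$; for $A\in\mathcal{A}_{n,1}^{-}$, $B(A)=-B(\overline{A})$ and $J(A)=J(\overline{A})$. Horizontal displacement: for an $m\times q$ $(0,1)$-matrix $P$ whose nonzero columns are $j_1<\dots<j_t$ with $j_1=1$ and $j_t<q$, $H(P)$ is the $m\times q$ matrix whose column $j_{s+1}$ equals column $j_s$ of $P$ for $1\le s\le t$ (where $j_{t+1}=q$), all other columns being zero. Vertical displacement: for an $m\times q$ $(0,1)$-matrix $P$ whose nonzero rows are $i_1<\dots<i_t$ with $i_1>1$ and $i_t=m$, $V(P)$ is the $m\times q$ matrix whose row $i_{s-1}$ equals row $i_s$ of $P$ for $1\le s\le t$ (where $i_0=1$), all other rows being zero. Partial discharging procedure: for $A\in\mathcal{A}_{n,1}^{+}\cup\mathcal{A}_{n,1}^{0}$, $\delta(A)$ is obtained by applying successively the following steps (all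 cells, rows and columns referring to the positions they occupy in $A$): (1) replace the $-1$ and the closing $1$ by $0$; (2) replace the submatrix occupying the extended closing cell by its image under $H$; (3) replace the submatrix occupying the extended neutral cell by its image under $V$; (4) lower the entries of the extended neutral cell and of the charged cell by one row: in the left side, for each row $t$ strictly below the opening row up to and including the closing row, the left part of row $t$ becomes the former left part of row $t-1$, and the left part of the opening row becomes zero; in the right side, for each row $t$ from two rows below the opening row up to and including the closing row, the right part of row $t$ becomes the former right part of row $t-1$, and the right part of the row immediately below the opening row becomes zero. The complete discharging procedure is $\Delta(A)=(k,\delta(A),c(A),E(A))$, where $k$ is the index of the opening row of $A$. It is known that $\Delta$ is injective on $\mathcal{A}_{n,1}^{+}\cup\mathcal{A}_{n,1}^{0}$, and that whenever $\Delta(A)=(k,P,c,E)$, there is a unique $N\in\mathcal{A}_{n,1}^{+}\cup\mathcal{A}_{n,1}^{0}$ with $\Delta(N)=(k,P,c+E,0)$, and this $N$ is neutral. Neutralizing procedure $\Lambda$: for $A\in\mathcal{A}_{n,1}^{+}\cup\mathcal{A}_{n,1}^{0}$ with $\Delta(A)=(k,P,c,E)$, $\Lambda(A)=(N,E)$ where $N$ is the unique element with $\Delta(N)=(k,P,c+E,0)$. For $A\in\mathcal{A}_{n,1}^{-}$, write $\Lambda(\overline{A})=(M,-E)$ and set $\Lambda(A)=(\overline{M},E)$. $\Lambda$ takes values in $\mathcal{N}_{n,1}=\{(N,E)\,:\,N\in\mathcal{A}_{n,1}^{0},\ E\in\mathbb{Z},\ -\ell(N)\le E\le c(N)\}$.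 Generalized inversion table: for $(N,E)\in\mathcal{N}_{n,1}$, let $n+1-k$ be the index of the opening row of $N$ (so the closing row is row $n+2-k$). For $1\le i\le n$, $a_i$ is the sum of the entries of $N$ lying strictly below row $n+1-i$ and strictly to the left of the unique $1$ of row $n+1-i$ (for $i=k-1$, i.e. the closing row, the leftmost $1$ of that row is used). Let $b=c(N)$ and $\beta=E+\ell(N)$. The generalized inversion table of $(N,E)$ is $(k;a_1,\dots,a_n;b,\beta)$. Mixed configurations: let $\mathcal{G}_n=\{(x,y)\in\mathbb{Z}^2: 0\le x<y\le n\}$. Steps are $E=(1,0)$, $F=(1,0)$ (a distinct letter from $E$ with the same displacement), $S=(0,-1)$, $N=(1,1)$. A mixed path is a lattice path all of whose vertices lie in $\mathcal{G}_n$, given as a word $LR$ where the Left part $L$ is a word in $\{S,E\}$ and the Right part $R$ is a word in $\{F,N\}$; the vertex where $L$ ends and $R$ begins is the junction. An order-$n$ mixed configuration is a sequence $(\omega_1,\dots,\omega_n)$ of mixed paths such that for some permutation $\sigma$ of $\{1,\dots,n\}$, $\omega_i$ starts at $(0,i)$ and ends at $(\sigma(i)-1,\sigma(i))$, the Left parts are pairwise vertex-disjoint, and the Right parts are pairwise vertex-disjoint. $\mathcal{M}_{n,s}$ is the set of order-$n$ mixed configurations containing exactly $s$ $N$-steps in total. For $(N,E)\in\mathcal{N}_{n,1}$ with generalized inversion table $(k;a_1,\dots,a_n;b,\beta)$, $\Phi(N,E)=(\omega_1,\dots,\omega_n)$ where $\omega_i=E^{a_i}F^{i-1-a_i}$ for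 $i\notin\{k-1,k\}$, $\omega_{k-1}=E^{a_{k-1}}F^{\beta}NF^{k-2-a_{k-1}-\beta}$, and $\omega_k=E^{a_k}SE^{b}F^{k-2-a_k-b}$ (exponents denote repetition of steps; $\omega_i$ starts at $(0,i)$). *)

theory Defs
  imports Main
begin

text \<open>An order-n matrix is a function on index pairs; rows and columns are indexed
  by 1..n and all entries outside {1..n} x {1..n} are required to be 0.\<close>

type_synonym mat = "nat \<Rightarrow> nat \<Rightarrow> int"

definition alternating :: "int list \<Rightarrow> bool" where
  "alternating xs \<longleftrightarrow>
     (let ys = filter (\<lambda>x. x \<noteq> 0) xs in
        ys \<noteq> [] \<and> hd ys = 1 \<and> last ys = 1 \<and>
        (\<forall>t. Suc t < length ys \<longrightarrow> ys ! Suc t = - (ys ! t)))"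

definition is_asm :: "nat \<Rightarrow> mat \<Rightarrow> bool" where
  "is_asm n A \<longleftrightarrow>
     (\<forall>i j. A i j \<in> {-1, 0, 1}) \<and>
     (\<forall>i j. \<not> (i \<in> {1..n} \<and> j \<in> {1..n}) \<longrightarrow> A i j = 0) \<and>
     (\<forall>i\<in>{1..n}. alternating (map (\<lambda>j. A i j) [1..<n+1])) \<and>
     (\<forall>j\<in>{1..n}. alternating (map (\<lambda>i. A i j) [1..<n+1]))"

definition num_neg :: "nat \<Rightarrow> mat \<Rightarrow> nat" where
  "num_neg n A = card {(i, j). i \<in> {1..n} \<and> j \<in> {1..n} \<and> A i j = -1}"

definition ASM :: "nat \<Rightarrow> nat \<Rightarrow> mat set" where
  "ASM n s = {A. is_asm n A \<and> num_neg n A = s}"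

definition rstat :: "mat \<Rightarrow> nat" where
  "rstat A = (LEAST j. A 1 j \<noteq> 0) - 1"

definition inv :: "nat \<Rightarrow> mat \<Rightarrow> int" where
  "inv n A = (\<Sum>i\<in>{1..n}. \<Sum>j\<in>{1..n}. \<Sum>k\<in>{i<..n}. \<Sum>l\<in>{1..<j}. A i j * A k l)"

definition bar :: "nat \<Rightarrow> mat \<Rightarrow> mat" where
  "bar n A = (\<lambda>i j. if i \<in> {1..n} \<and> j \<in> {1..n} then A i (n + 1 - j) else 0)"

definition neg_pos :: "mat \<Rightarrow> nat \<times> nat" where
  "neg_pos A = (THE p. A (fst p) (snd p) = -1)"

definition clos_row :: "mat \<Rightarrow> nat" where "clos_row A = fst (neg_pos A)"
definition open_col :: "mat \<Rightarrow> nat" where "open_col A = snd (neg_pos A)"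

definition open_row :: "mat \<Rightarrow> nat" where
  "open_row A = (THE i. i < clos_row A \<and> A i (open_col A) = 1)"

definition clos_col :: "mat \<Rightarrow> nat" where
  "clos_col A = (THE j. open_col A < j \<and> A (clos_row A) j = 1)"

definition one_col :: "mat \<Rightarrow> nat \<Rightarrow> nat" where
  "one_col A i = (THE j. A i j = 1)"

definition neutral :: "mat \<Rightarrow> bool" where
  "neutral A \<longleftrightarrow> open_row A + 1 = clos_row A"

definition positive :: "mat \<Rightarrow> bool" where
  "positive A \<longleftrightarrow> \<not> neutral A \<and> open_col A < one_col A (clos_row A - 1)"

definition negative :: "mat \<Rightarrow> bool" where
  "negative A \<longleftrightarrow> \<not> neutral A \<and> one_col A (clos_row A - 1) < open_col A"

definition ASM1pos :: "nat \<Rightarrow> mat set" where "ASM1pos n = {A \<in> ASM n 1. positive A}"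
definition ASM1neu :: "nat \<Rightarrow> mat set" where "ASM1neu n = {A \<in> ASM n 1. neutral A}"
definition ASM1neg :: "nat \<Rightarrow> mat set" where "ASM1neg n = {A \<in> ASM n 1. negative A}"

definition charge :: "nat \<Rightarrow> mat \<Rightarrow> int" where
  "charge n A = (\<Sum>i\<in>{open_row A<..<clos_row A}. \<Sum>j\<in>{open_col A<..n}. A i j)"

definition Epar :: "nat \<Rightarrow> mat \<Rightarrow> int" where
  "Epar n A = (if positive A then charge n A
               else if neutral A then 0
               else - charge n (bar n A))"

definition lead_row :: "mat \<Rightarrow> nat" where
  "lead_row A = (LEAST i. open_row A < i \<and> (\<exists>j. j < open_col A \<and> A i j = 1))"

definition lead_col :: "mat \<Rightarrow> nat" where
  "lead_col A = (THE j. j < open_col A \<and> A (lead_row A) j = 1)"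

definition ell :: "nat \<Rightarrow> mat \<Rightarrow> int" where
  "ell n A = (\<Sum>i\<in>{open_row A<..n}. \<Sum>j\<in>{lead_col A<..<open_col A}. A i j)"

definition cc :: "nat \<Rightarrow> mat \<Rightarrow> int" where
  "cc n A = (\<Sum>i\<in>{clos_row A<..n}. \<Sum>j\<in>{open_col A<..<clos_col A}. A i j)"

definition Bpar :: "nat \<Rightarrow> mat \<Rightarrow> int" where
  "Bpar n A = (if negative A then - (cc n (bar n A) - ell n (bar n A))
               else cc n A - ell n A)"

definition Jbase :: "nat \<Rightarrow> mat \<Rightarrow> int" where
  "Jbase n A = cc n A + ell n A + \<bar>Epar n A\<bar> + 1"

definition Jpar :: "nat \<Rightarrow> mat \<Rightarrow> int" where
  "Jpar n A = (if negative A then Jbase n (bar n A) else Jbase n A)"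

text \<open>Horizontal displacement H applied to the block of P with rows rs and
  columns a..b (the block's column 1 is column a, its last column is b);
  entries outside the block are unchanged.\<close>
definition hdisp :: "mat \<Rightarrow> nat set \<Rightarrow> nat \<Rightarrow> nat \<Rightarrow> mat" where
  "hdisp P rs a b = (\<lambda>i j.
     if i \<in> rs \<and> j \<in> {a..b} then
       (let NZ = {j' \<in> {a..b}. \<exists>i' \<in> rs. P i' j' \<noteq> 0} in
        if (j \<in> NZ \<or> j = b) \<and> (\<exists>j' \<in> NZ. j' < j)
        then P i (Max {j' \<in> NZ. j' < j}) else 0)
     else P i j)"

text \<open>Vertical displacement V applied to the block of P with rows a..b
  (the block's row 1 is row a, its last row is b) and columns cs.\<close>
definition vdisp :: "mat \<Rightarrow> nat set \<Rightarrow> nat \<Rightarrow> nat \<Rightarrow> mat" where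
  "vdisp P cs a b = (\<lambda>i j.
     if i \<in> {a..b} \<and> j \<in> cs then
       (let NZ = {i' \<in> {a..b}. \<exists>j' \<in> cs. P i' j' \<noteq> 0} in
        if (i \<in> NZ \<or> i = a) \<and> (\<exists>i' \<in> NZ. i < i')
        then P (Min {i' \<in> NZ. i < i'}) j else 0)
     else P i j)"

definition delta :: "nat \<Rightarrow> mat \<Rightarrow> mat" where
  "delta n A = (let o' = open_row A; p = clos_row A; q = open_col A; c = clos_col A;
      M1 = (\<lambda>i j. if i = p \<and> (j = q \<or> j = c) then 0 else A i j);
      M2 = hdisp M1 {p<..n} q c;
      M3 = vdisp M2 {1..<q} o' p
    in (\<lambda>i j.
      if j \<in> {1..<q} \<and> o' \<le> i \<and> i \<le> p then (if i = o' then 0 else M3 (i - 1) j)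
      else if j \<in> {q<..n} \<and> o' + 1 \<le> i \<and> i \<le> p then (if i = o' + 1 then 0 else M3 (i - 1) j)
      else M3 i j))"

definition Delta :: "nat \<Rightarrow> mat \<Rightarrow> nat \<times> mat \<times> int \<times> int" where
  "Delta n A = (open_row A, delta n A, cc n A, Epar n A)"

definition Lambda_pos :: "nat \<Rightarrow> mat \<Rightarrow> mat \<times> int" where
  "Lambda_pos n A = (case Delta n A of (k, P, c, E) \<Rightarrow>
     ((THE N. N \<in> ASM1pos n \<union> ASM1neu n \<and> Delta n N = (k, P, c + E, 0)), E))"

definition Lambda :: "nat \<Rightarrow> mat \<Rightarrow> mat \<times> int" where
  "Lambda n A = (if negative A
      then (case Lambda_pos n (bar n A) of (M, E') \<Rightarrow> (bar n M, - E'))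
      else Lambda_pos n A)"

definition git_k :: "nat \<Rightarrow> mat \<Rightarrow> nat" where
  "git_k n N = n + 1 - open_row N"

text \<open>a_i; for the closing row the leftmost 1 is used (LEAST), for all other
  rows this is the unique 1.\<close>
definition git_a :: "nat \<Rightarrow> mat \<Rightarrow> nat \<Rightarrow> int" where
  "git_a n N i = (let r = n + 1 - i in
     \<Sum>i'\<in>{r<..n}. \<Sum>j\<in>{1..<(LEAST j. N r j = 1)}. N i' j)"

definition git_b :: "nat \<Rightarrow> mat \<Rightarrow> int" where
  "git_b n N = cc n N"

definition git_beta :: "nat \<Rightarrow> mat \<Rightarrow> int \<Rightarrow> int" where
  "git_beta n N E = E + ell n N"

datatype step = StE | StF | StS | StN

fun step_vec :: "step \<Rightarrow> int \<times> int" where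
  "step_vec StE = (1, 0)"
| "step_vec StF = (1, 0)"
| "step_vec StS = (0, -1)"
| "step_vec StN = (1, 1)"

fun walk :: "int \<times> int \<Rightarrow> step list \<Rightarrow> int \<times> int" where
  "walk v [] = v"
| "walk (x, y) (s # ss) = walk (x + fst (step_vec s), y + snd (step_vec s)) ss"

text \<open>A configuration is given by the step words of its paths; path i starts at (0,i).\<close>
type_synonym config = "nat \<Rightarrow> step list"

definition occ :: "nat \<Rightarrow> config \<Rightarrow> (nat \<times> nat) set" where
  "occ n \<Omega> = {(i, t). i \<in> {1..n} \<and> t < length (\<Omega> i)}"

definition st_start :: "config \<Rightarrow> nat \<times> nat \<Rightarrow> int \<times> int" where
  "st_start \<Omega> s = walk (0, int (fst s)) (take (snd s) (\<Omega> (fst s)))"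

definition st_end :: "config \<Rightarrow> nat \<times> nat \<Rightarrow> int \<times> int" where
  "st_end \<Omega> s = walk (0, int (fst s)) (take (Suc (snd s)) (\<Omega> (fst s)))"

definition st_kind :: "config \<Rightarrow> nat \<times> nat \<Rightarrow> step" where
  "st_kind \<Omega> s = \<Omega> (fst s) ! snd s"

definition junction :: "config \<Rightarrow> nat \<Rightarrow> int \<times> int" where
  "junction \<Omega> i = walk (0, int i) (takeWhile (\<lambda>s. s \<in> {StS, StE}) (\<Omega> i))"

definition Phi :: "nat \<Rightarrow> mat \<Rightarrow> int \<Rightarrow> config" where
  "Phi n N E = (\<lambda>i.
     let k = git_k n N; a = git_a n N; b = git_b n N; \<beta> = git_beta n N E in
     if i = k - 1 then
       replicate (nat (a i)) StE @ replicate (nat \<beta>) StF @ [StN]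
         @ replicate (nat (int k - 2 - a i - \<beta>)) StF
     else if i = k then
       replicate (nat (a i)) StE @ [StS] @ replicate (nat b) StE
         @ replicate (nat (int k - 2 - a i - b)) StF
     else replicate (nat (a i)) StE @ replicate (nat (int i - 1 - a i)) StF)"

end

theory Submission
  imports Defs
begin

text \<open>An alternating sign matrix with exactly one entry -1 is a permutation matrix modified at an
  occurrence of the pattern 213. In these coordinates \<open>delta n A\<close> is the matrix of an
  explicit permutation \<open>\<pi>\<close>: the 1s of the left side move up to just below the previous left 1, the
  1s of the charged cell move down by one row, and the columns of the extended closing cell are
  shifted monotonically. Comparing inversions row by row, only the charged 1s lose one inversion
  each, whence \<open>inv n A = inv \<pi> + c(A) + E(A) + 1\<close>. Likewise \<open>r\<close> and \<open>\<ell>\<close> depend on \<open>\<pi>\<close> and the opening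
  row only, so they agree for \<open>A\<close> and its neutralization \<open>N\<close>, where \<open>c(N) = c(A) + E(A)\<close>. The matrix
  \<open>N\<close> exists and is unique because its closing column is the column to the right of the opening column
  that has exactly \<open>c(N)\<close> predecessors among those meeting \<open>\<pi>\<close> below the closing row of \<open>N\<close>.
  Negative matrices reduce to positive ones by reflection, under which \<open>inv\<close> and \<open>r\<close> are
  complemented and, for neutral matrices, \<open>c\<close> and \<open>\<ell>\<close> are exchanged.\<close>

section \<open>Matrices with one entry -1 as pattern occurrences\<close>

text \<open>Recording \<open>f\<close> instead of the permutation \<open>f(m := c)\<close> turns
  every sum of entries over a block into a count of rows plus a correction carried by row
  \<open>p\<close> alone: \<open>f\<close> takes the value \<open>q\<close> twice and misses
  \<open>c\<close>, and the entries -1 and 1 of row \<open>p\<close> in these columns repair exactly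
  that. The obstacle is that discharging displaces whole blocks, while inversions compare rows of
  different blocks. Hence each 1 is followed to its new position (\<open>phi\<close> for rows,
  \<open>shift\<close> for columns), and the sum of the entries southwest of it is compared before
  and after. A charged 1 loses one because the next left 1 below it is raised past it. The constant
  1 in the inversion formula is the 1 of the opening column below the -1: the closing 1 sees it to
  its southwest, the -1 does not. The description of \<open>delta\<close> and this comparison hold
  for every sign; the sign enters when the number of right 1s in the enclosed rows is read as
  \<open>Epar\<close>.\<close>

lemma filter_map_upt:
  "filter P (map h [1..<n+1]) = map h (sorted_list_of_set {i\<in>{1..n}. P (h i)})"
proof -
  have "set (filter (P \<circ> h) [1..<n+1]) = {i\<in>{1..n}. P (h i)}" by auto
  moreover have "sorted_list_of_set (set (filter (P \<circ> h) [1..<n+1])) = filter (P \<circ> h) [1..<n+1]"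
    by (intro sorted_list_of_set.idem_if_sorted_distinct) (simp_all del: upt_Suc add: sorted_wrt_filter)
  ultimately show ?thesis by (simp only: filter_map)
qed

lemma alternating_single:
  assumes "k \<in> {1..n}" and "\<And>j. j \<in> {1..n} \<Longrightarrow> h j = of_bool (j = k)"
  shows "alternating (map h [1..<n+1])"
proof -
  have "{i\<in>{1..n}. h i \<noteq> 0} = {k}" using assms by auto
  then have "filter (\<lambda>x. x \<noteq> 0) (map h [1..<n+1]) = [1]"
    using assms by (simp only: filter_map_upt) simp
  then show ?thesis by (simp only: alternating_def Let_def) simp
qed

lemma alternating_triple:
  assumes "1 \<le> l" "l < q" "q < c" "c \<le> n"
    and "\<And>j. j \<in> {1..n} \<Longrightarrow> h j = of_bool (j = l) - of_bool (j = q) + of_bool (j = c)"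
  shows "alternating (map h [1..<n+1])"
proof -
  have "{i\<in>{1..n}. h i \<noteq> 0} = set [l, q, c]" using assms by (auto split: if_splits simp: of_bool_def)
  moreover have "sorted_list_of_set (set [l, q, c]) = [l, q, c]"
    using assms by (intro sorted_list_of_set.idem_if_sorted_distinct) auto
  moreover have "map h [l, q, c] = [1, -1, 1]" using assms by simp
  ultimately have "filter (\<lambda>x. x \<noteq> 0) (map h [1..<n+1]) = [1, -1, 1]"
    by (simp only: filter_map_upt)
  then show ?thesis by (simp only: alternating_def Let_def) (auto simp: less_Suc_eq)
qed

text \<open>With four or more nonzero entries, positions 1 and 3 would both carry -1, against
  \<open>uniq\<close>; with two, the last entry would be -1.\<close>

lemma alternating_cases:
  assumes alt: "alternating (map h [1..<n+1])"
    and vals: "\<And>j. h j \<in> {-1, 0, 1}"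
    and uniq: "\<And>j j'. j \<in> {1..n} \<Longrightarrow> j' \<in> {1..n} \<Longrightarrow> h j = -1 \<Longrightarrow> h j' = -1 \<Longrightarrow> j = j'"
  obtains (single) k where "k \<in> {1..n}" "\<And>j. j \<in> {1..n} \<Longrightarrow> h j = of_bool (j = k)"
  | (triple) l q c where "1 \<le> l" "l < q" "q < c" "c \<le> n"
      "\<And>j. j \<in> {1..n} \<Longrightarrow> h j = of_bool (j = l) - of_bool (j = q) + of_bool (j = c)"
proof -
  define xs where "xs = sorted_list_of_set {i\<in>{1..n}. h i \<noteq> 0}"
  have set_xs: "set xs = {i\<in>{1..n}. h i \<noteq> 0}" and dist: "distinct xs" and sorted: "sorted xs"
    by (auto simp: xs_def)
  have "xs \<noteq> []" "hd (map h xs) = 1" "last (map h xs) = 1"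
    and step: "\<And>t. Suc t < length xs \<Longrightarrow> h (xs ! Suc t) = - h (xs ! t)"
    using alt by (simp_all only: alternating_def Let_def filter_map_upt xs_def[symmetric]) auto
  then have h0: "h (xs ! 0) = 1" and hl: "h (xs ! (length xs - 1)) = 1"
    by (auto simp: hd_conv_nth last_conv_nth hd_map last_map)
  have "length xs < 4"
  proof (rule ccontr)
    assume "\<not> length xs < 4"
    then have "h (xs ! 1) = -1" "h (xs ! 3) = -1" "xs ! 1 \<in> set xs" "xs ! 3 \<in> set xs" "xs ! 1 \<noteq> xs ! 3"
      using h0 step[of 0] step[of 1] step[of 2] dist
      by (auto simp: numeral_2_eq_2 numeral_3_eq_3 nth_eq_iff_index_eq)
    then show False using uniq[of "xs ! 1" "xs ! 3"] set_xs by auto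
  qed
  moreover have "length xs \<noteq> 2" using h0 hl step[of 0] by auto
  ultimately consider "length xs = 1" | "length xs = 3" using \<open>xs \<noteq> []\<close>
    by (cases "length xs") (auto simp: less_Suc_eq numeral_eq_Suc)
  then show thesis
  proof cases
    case 1
    then obtain k where xs: "xs = [k]" by (cases xs) auto
    show ?thesis
      by (rule single[of k]) (use set_xs h0 xs in \<open>auto simp: of_bool_def set_eq_iff\<close>)
  next
    case 2
    then obtain l q c where xs: "xs = [l, q, c]"
      by (auto simp: numeral_3_eq_3 length_Suc_conv)
    have "h l = 1" "h q = -1" "h c = 1" using h0 step[of 0] step[of 1] xs by auto
    then show ?thesis
      using set_xs xs dist sorted
      by (intro triple[of l q c]) (auto simp: of_bool_def set_eq_iff)
  qed
qed

text \<open>The elements of \<open>ASM n 1\<close> correspond to the occurrences \<open>u < p < m\<close>, \<open>g p < g u < g m\<close> of the pattern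
  213 in a permutation $g$; here \<open>f = g(m := g u)\<close> records the column of the leftmost 1 of each row
  and \<open>c = g m\<close> is the closing column.\<close>

locale one_neg =
  fixes n :: nat and A :: mat and f :: "nat \<Rightarrow> nat" and u p m q c :: nat
  assumes entry: "A i j = (if i \<in> {1..n} \<and> j \<in> {1..n}
      then of_bool (j = f i) + of_bool (i = p) * (of_bool (j = c) - of_bool (j = q)) else 0)"
    and bij: "bij_betw (f(m := c)) {1..n} {1..n}"
    and rows: "1 \<le> u" "u < p" "p < m" "m \<le> n"
    and cols: "f p < q" "q < c"
    and f_u: "f u = q" and f_m: "f m = q"
begin

lemma c_le: "c \<le> n"
  using bspec[OF bij_betwE[OF bij], of m] rows by simp

lemma f_range: "i \<in> {1..n} \<Longrightarrow> f i \<in> {1..n}"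
  using bspec[OF bij_betwE[OF bij], of i] rows cols c_le f_m by (cases "i = m") auto

lemma f_neq_c: "i \<in> {1..n} \<Longrightarrow> f i \<noteq> c"
  using inj_onD[OF bij_betw_imp_inj_on[OF bij], of i m] rows cols f_m by (cases "i = m") auto

lemma f_eq: "i \<in> {1..n} \<Longrightarrow> i' \<in> {1..n} \<Longrightarrow> f i = f i' \<Longrightarrow> i \<noteq> m \<Longrightarrow> i' \<noteq> m \<Longrightarrow> i = i'"
  using inj_onD[OF bij_betw_imp_inj_on[OF bij], of i i'] by auto

lemma f_eq_q: "i \<in> {1..n} \<Longrightarrow> f i = q \<longleftrightarrow> i = u \<or> i = m"
  using f_eq[of i u] f_u f_m rows by auto

lemma f_surj: "j \<in> {1..n} \<Longrightarrow> j \<noteq> c \<Longrightarrow> \<exists>i\<in>{1..n}. i \<noteq> m \<and> f i = j"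
proof -
  assume j: "j \<in> {1..n}" "j \<noteq> c"
  then have "j \<in> (f(m := c)) ` {1..n}" by (simp only: bij_betw_imp_surj_on[OF bij])
  then obtain i where "i \<in> {1..n}" "(f(m := c)) i = j" by (metis imageE)
  then show ?thesis using j by (auto split: if_splits)
qed

lemma row_other: "i \<in> {1..n} \<Longrightarrow> i \<noteq> p \<Longrightarrow> j \<in> {1..n} \<Longrightarrow> A i j = of_bool (j = f i)"
  by (simp add: entry)

lemma row_p: "j \<in> {1..n} \<Longrightarrow> A p j = of_bool (j = f p) - of_bool (j = q) + of_bool (j = c)"
  using rows by (simp add: entry)

lemma col_q: "i \<in> {1..n} \<Longrightarrow> A i q = of_bool (i = u) - of_bool (i = p) + of_bool (i = m)"
  using rows cols c_le f_eq_q by (auto simp: entry)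

lemma neg_iff: "A i j = -1 \<longleftrightarrow> i = p \<and> j = q"
  using rows cols c_le by (auto simp: entry of_bool_def split: if_splits)

lemma one_iff: "A i j = 1 \<longleftrightarrow> i \<in> {1..n} \<and> (j = f i \<and> (j \<noteq> q \<or> i \<noteq> p) \<or> i = p \<and> j = c)"
  using rows cols c_le f_range[of i] by (auto simp: entry of_bool_def split: if_splits)

lemma in_ASM: "A \<in> ASM n 1"
proof -
  have "alternating (map (\<lambda>j. A i j) [1..<n+1])" if i: "i \<in> {1..n}" for i
  proof (cases "i = p")
    case True
    then show ?thesis using row_p cols c_le f_range[OF i]
      by (intro alternating_triple[of "f p" q c]) auto
  next
    case False
    then show ?thesis using row_other[OF i] f_range[OF i] by (intro alternating_single[of "f i"]) auto
  qed
  moreover have "alternating (map (\<lambda>i. A i j) [1..<n+1])" if j: "j \<in> {1..n}" for j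
  proof -
    consider "j = q" | "j = c" | "j \<noteq> q" "j \<noteq> c" by blast
    then show ?thesis
    proof cases
      case 1
      then show ?thesis using col_q rows by (intro alternating_triple[of u p m]) auto
    next
      case 2
      then show ?thesis using rows cols j f_neq_c
        by (intro alternating_single[of p]) (auto simp: entry)
    next
      case 3
      obtain i where i: "i \<in> {1..n}" "i \<noteq> m" "f i = j" using f_surj[OF j 3(2)] by auto
      have "A i' j = of_bool (i' = i)" if "i' \<in> {1..n}" for i'
      proof -
        have "j = f i' \<longleftrightarrow> i' = i" using that i 3 f_eq[of i' i] f_m by metis
        then show ?thesis using that 3 j by (simp add: entry)
      qed
      then show ?thesis using i by (intro alternating_single[of i]) auto
    qed
  qed
  moreover have "A i j \<in> {-1, 0, 1}" for i j
    using rows cols by (auto simp: entry of_bool_def)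
  moreover have "num_neg n A = 1"
  proof -
    have "{(i, j). i \<in> {1..n} \<and> j \<in> {1..n} \<and> A i j = -1} = {(p, q)}"
      using neg_iff rows cols c_le by auto
    then show ?thesis by (simp add: num_neg_def)
  qed
  moreover have "\<not> (i \<in> {1..n} \<and> j \<in> {1..n}) \<longrightarrow> A i j = 0" for i j
    by (subst entry) simp
  ultimately show ?thesis unfolding ASM_def is_asm_def by blast
qed

section \<open>Opening and closing data, sign and reflection in coordinates\<close>

lemma neg_pos_eq: "neg_pos A = (p, q)"
  unfolding neg_pos_def by (rule the_equality) (auto simp: neg_iff prod_eq_iff)

lemma clos_row_eq: "clos_row A = p" and open_col_eq: "open_col A = q"
  by (simp_all add: clos_row_def open_col_def neg_pos_eq)

lemma open_row_eq: "open_row A = u"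
  unfolding open_row_def clos_row_eq open_col_eq
  by (rule the_equality) (use rows cols f_u f_eq_q in \<open>force simp: one_iff\<close>)+

lemma clos_col_eq: "clos_col A = c"
  unfolding clos_col_def clos_row_eq open_col_eq
  by (rule the_equality) (use rows cols in \<open>auto simp: one_iff\<close>)

lemma one_col_eq: "i \<in> {1..n} \<Longrightarrow> i \<noteq> p \<Longrightarrow> one_col A i = f i"
  unfolding one_col_def by (rule the_equality) (auto simp: one_iff)

lemma neutral_iff: "neutral A \<longleftrightarrow> p = Suc u"
  by (auto simp: neutral_def open_row_eq clos_row_eq)

lemma positive_iff: "positive A \<longleftrightarrow> p \<noteq> Suc u \<and> q < f (p - 1)"
  using rows one_col_eq[of "p - 1"] by (cases p) (auto simp: positive_def neutral_iff open_col_eq clos_row_eq)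

lemma negative_iff: "negative A \<longleftrightarrow> p \<noteq> Suc u \<and> f (p - 1) < q"
  using rows one_col_eq[of "p - 1"] by (cases p) (auto simp: negative_def neutral_iff open_col_eq clos_row_eq)

lemma sign_cases: "p = Suc u \<or> q < f (p - 1) \<or> f (p - 1) < q"
  using f_eq_q[of "p - 1"] rows by force

text \<open>Reflection exchanges the two 1s of the closing row, so the old closing 1 becomes the
  leftmost one and the new closing column comes from \<open>f p\<close>. Rows \<open>u\<close>,
  \<open>p\<close>, \<open>m\<close> are unchanged, so every fact of the locale is available for
  \<open>bar n A\<close>.\<close>

lemma bar_one_neg:
  "one_neg n (bar n A) (\<lambda>i. n + 1 - (f(p := c)) i) u p m (n + 1 - q) (n + 1 - f p)"
proof
  let ?f = "\<lambda>i. n + 1 - (f(p := c)) i"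
  show "bar n A i j = (if i \<in> {1..n} \<and> j \<in> {1..n}
      then of_bool (j = ?f i) + of_bool (i = p) * (of_bool (j = n + 1 - f p) - of_bool (j = n + 1 - q))
      else 0)" for i j
  proof (cases "i \<in> {1..n} \<and> j \<in> {1..n}")
    case True
    then have j: "n + 1 - j \<in> {1..n}" by auto
    have flip: "n + 1 - j = x \<longleftrightarrow> j = n + 1 - x" if "x \<in> {1..n}" for x using that True by auto
    have "bar n A i j = of_bool (n + 1 - j = f i)
        + of_bool (i = p) * (of_bool (n + 1 - j = c) - of_bool (n + 1 - j = q))"
      unfolding bar_def entry[of i "n + 1 - j"] using True j by simp
    also have "\<dots> = of_bool (j = n + 1 - f i)
        + of_bool (i = p) * (of_bool (j = n + 1 - c) - of_bool (j = n + 1 - q))"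
      using flip[of "f i"] flip[of c] flip[of q] f_range True rows cols c_le by simp
    also have "\<dots> = of_bool (j = ?f i)
        + of_bool (i = p) * (of_bool (j = n + 1 - f p) - of_bool (j = n + 1 - q))"
      by simp
    finally show ?thesis using True by simp
  next
    case False
    then show ?thesis unfolding bar_def by (simp only: if_False)
  qed
  have "j \<in> (?f(m := n + 1 - f p)) ` {1..n}" if j: "j \<in> {1..n}" for j
  proof -
    have "n + 1 - j \<in> (f(m := c)) ` {1..n}" using j bij by (auto simp: bij_betw_def)
    then obtain i where i: "i \<in> {1..n}" "(f(m := c)) i = n + 1 - j" by (metis imageE)
    \<comment> \<open>At \<open>p\<close> and \<open>m\<close> the new permutation takes the
      mirrored values of \<open>f(m := c)\<close> at \<open>m\<close> and \<open>p\<close>; swapping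
      these rows gives the preimage.\<close>
    define i' where "i' = (if i = m then p else if i = p then m else i)"
    have "(?f(m := n + 1 - f p)) i' = n + 1 - (f(m := c)) i" using rows by (simp add: i'_def)
    also have "\<dots> = j" using i j by auto
    finally show ?thesis using i rows by (intro image_eqI[of _ _ i']) (auto simp: i'_def)
  qed
  moreover have "(?f(m := n + 1 - f p)) i \<in> {1..n}" if "i \<in> {1..n}" for i
    using f_range[OF that] f_range[of p] rows cols c_le by auto
  ultimately have "(?f(m := n + 1 - f p)) ` {1..n} = {1..n}" by blast
  then show "bij_betw (?f(m := n + 1 - f p)) {1..n} {1..n}"
    by (simp add: bij_betw_def eq_card_imp_inj_on)
  have "f p \<in> {1..n}" using f_range rows by simp
  then show "?f p < n + 1 - q" "n + 1 - q < n + 1 - f p" using cols c_le by auto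
  show "?f u = n + 1 - q" "?f m = n + 1 - q" using rows f_u f_m by simp_all
qed (rule rows)+

end

text \<open>Rows other than \<open>p\<close> and columns other than \<open>q\<close> contain no -1,
  hence a single 1; row \<open>p\<close> and column \<open>q\<close> have the triple form. The
  columns give surjectivity of \<open>f(m := c)\<close>, and injectivity follows by
  counting.\<close>

lemma ASM_one_neg:
  assumes A: "A \<in> ASM n 1"
  obtains f u p m q c where "one_neg n A f u p m q c"
proof -
  have vals: "A i j \<in> {-1, 0, 1}" for i j using A by (auto simp: ASM_def is_asm_def)
  have out: "\<not> (i \<in> {1..n} \<and> j \<in> {1..n}) \<Longrightarrow> A i j = 0" for i j
    using A by (auto simp: ASM_def is_asm_def)
  have alt_row: "i \<in> {1..n} \<Longrightarrow> alternating (map (A i) [1..<n+1])" for i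
    using A unfolding ASM_def is_asm_def by blast
  have alt_col: "j \<in> {1..n} \<Longrightarrow> alternating (map (\<lambda>i. A i j) [1..<n+1])" for j
    using A unfolding ASM_def is_asm_def by blast
  have "card {(i, j). i \<in> {1..n} \<and> j \<in> {1..n} \<and> A i j = -1} = 1"
    using A by (simp add: ASM_def num_neg_def)
  then obtain x where "{(i, j). i \<in> {1..n} \<and> j \<in> {1..n} \<and> A i j = -1} = {x}"
    by (rule card_1_singletonE)
  then obtain p q where pq: "{(i, j). i \<in> {1..n} \<and> j \<in> {1..n} \<and> A i j = -1} = {(p, q)}"
    by (cases x) auto
  then have neg: "A i j = -1 \<longleftrightarrow> i = p \<and> j = q" for i j
    using out[of i j] by (fastforce simp: set_eq_iff)
  have p: "p \<in> {1..n}" and q: "q \<in> {1..n}" using pq by auto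
  have single_row: "\<exists>k\<in>{1..n}. \<forall>j\<in>{1..n}. A i j = of_bool (j = k)" if i: "i \<in> {1..n}" "i \<noteq> p" for i
  proof (rule alternating_cases[OF alt_row[OF i(1)] vals])
    fix l q' c' assume "1 \<le> l" "l < q'" "q' < c'" "c' \<le> n"
      "\<And>j. j \<in> {1..n} \<Longrightarrow> A i j = of_bool (j = l) - of_bool (j = q') + of_bool (j = c')"
    then have "A i q' = -1" by auto
    then show ?thesis using neg i by auto
  qed (auto simp: neg)
  have single_col: "\<exists>k\<in>{1..n}. \<forall>i\<in>{1..n}. A i j = of_bool (i = k)" if j: "j \<in> {1..n}" "j \<noteq> q" for j
  proof (rule alternating_cases[OF alt_col[OF j(1)] vals])
    fix l q' c' assume "1 \<le> l" "l < q'" "q' < c'" "c' \<le> n"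
      "\<And>i. i \<in> {1..n} \<Longrightarrow> A i j = of_bool (i = l) - of_bool (i = q') + of_bool (i = c')"
    then have "A q' j = -1" by auto
    then show ?thesis using neg j by auto
  qed (auto simp: neg)
  obtain l c where lc: "1 \<le> l" "l < q" "q < c" "c \<le> n"
    and row_p: "\<And>j. j \<in> {1..n} \<Longrightarrow> A p j = of_bool (j = l) - of_bool (j = q) + of_bool (j = c)"
  proof (rule alternating_cases[OF alt_row[OF p] vals])
    fix k assume "\<And>j. j \<in> {1..n} \<Longrightarrow> A p j = of_bool (j = k)"
    then show thesis using neg[of p q] q by (auto simp: of_bool_def split: if_splits)
  next
    fix l q' c' assume *: "1 \<le> l" "l < q'" "q' < c'" "c' \<le> n"
      "\<And>j. j \<in> {1..n} \<Longrightarrow> A p j = of_bool (j = l) - of_bool (j = q') + of_bool (j = c')"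
    then have "A p q' = -1" by auto
    then have "q' = q" using neg by auto
    then show thesis using * that by blast
  qed (auto simp: neg)
  obtain u m where um: "1 \<le> u" "u < p" "p < m" "m \<le> n"
    and col_q: "\<And>i. i \<in> {1..n} \<Longrightarrow> A i q = of_bool (i = u) - of_bool (i = p) + of_bool (i = m)"
  proof (rule alternating_cases[OF alt_col[OF q] vals])
    fix k assume "\<And>j. j \<in> {1..n} \<Longrightarrow> A j q = of_bool (j = k)"
    then show thesis using neg[of p q] p by (auto simp: of_bool_def split: if_splits)
  next
    fix l q' c' assume *: "1 \<le> l" "l < q'" "q' < c'" "c' \<le> n"
      "\<And>j. j \<in> {1..n} \<Longrightarrow> A j q = of_bool (j = l) - of_bool (j = q') + of_bool (j = c')"
    then have "A q' q = -1" by auto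
    then have "q' = p" using neg by auto
    then show thesis using * that by blast
  qed (auto simp: neg)
  obtain g where g: "\<And>i. i \<in> {1..n} \<Longrightarrow> i \<noteq> p \<Longrightarrow> g i \<in> {1..n} \<and> (\<forall>j\<in>{1..n}. A i j = of_bool (j = g i))"
    using single_row by metis
  define f where "f = g(p := l)"
  have f_range: "f i \<in> {1..n}" if "i \<in> {1..n}" for i
    using g[OF that] lc by (auto simp: f_def)
  have entry: "A i j = (if i \<in> {1..n} \<and> j \<in> {1..n}
      then of_bool (j = f i) + of_bool (i = p) * (of_bool (j = c) - of_bool (j = q)) else 0)" for i j
    using g[of i] row_p[of j] out[of i j] by (auto simp: f_def)
  have f_u: "f u = q" and f_m: "f m = q"
    using col_q[of u] col_q[of m] g[of u] g[of m] um q by (auto simp: f_def of_bool_def split: if_splits)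
  have "{1..n} \<subseteq> (f(m := c)) ` {1..n}"
  proof
    fix j assume j: "j \<in> {1..n}"
    consider "j = q" | "j = c" | "j \<noteq> q" "j \<noteq> c" by blast
    then show "j \<in> (f(m := c)) ` {1..n}"
    proof cases
      case 1 then show ?thesis using f_u um by (intro image_eqI[of _ _ u]) auto
    next
      case 2 then show ?thesis using um by (intro image_eqI[of _ _ m]) auto
    next
      case 3
      then obtain k where k: "k \<in> {1..n}" "A k j = 1" using single_col[OF j] by fastforce
      then have "f k = j" using 3 j by (auto simp: entry split: if_splits)
      then show ?thesis using k 3 f_m by (intro image_eqI[of _ _ k]) auto
    qed
  qed
  moreover have "(f(m := c)) ` {1..n} \<subseteq> {1..n}" using f_range lc by auto
  ultimately have "(f(m := c)) ` {1..n} = {1..n}" by blast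
  then have "bij_betw (f(m := c)) {1..n} {1..n}"
    by (simp add: bij_betw_def eq_card_imp_inj_on)
  then have "one_neg n A f u p m q c"
    using entry um lc f_u f_m by unfold_locales (auto simp: f_def)
  then show thesis by (rule that)
qed

section \<open>The discharged permutation\<close>

definition nxt :: "nat set \<Rightarrow> nat \<Rightarrow> nat" where "nxt S x = Min {y \<in> S. x < y}"
definition prv :: "nat set \<Rightarrow> nat \<Rightarrow> nat" where "prv S x = Max {y \<in> S. y < x}"

lemma nxt_props:
  assumes "finite S" "y \<in> S" "x < y"
  shows "nxt S x \<in> S" "x < nxt S x" "nxt S x \<le> y"
proof -
  have "finite {y \<in> S. x < y}" "y \<in> {y \<in> S. x < y}" using assms by auto
  then have "Min {y \<in> S. x < y} \<in> {y \<in> S. x < y}" "Min {y \<in> S. x < y} \<le> y"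
    by (metis Min_in empty_iff, metis Min_le)
  then show "nxt S x \<in> S" "x < nxt S x" "nxt S x \<le> y" by (auto simp: nxt_def)
qed

lemma prv_props:
  assumes "finite S" "y \<in> S" "y < x"
  shows "prv S x \<in> S" "prv S x < x" "y \<le> prv S x"
proof -
  have "finite {y \<in> S. y < x}" "y \<in> {y \<in> S. y < x}" using assms by auto
  then have "Max {y \<in> S. y < x} \<in> {y \<in> S. y < x}" "y \<le> Max {y \<in> S. y < x}"
    by (metis Max_in empty_iff, metis Max_ge)
  then show "prv S x \<in> S" "prv S x < x" "y \<le> prv S x" by (auto simp: prv_def)
qed

lemma prv_nxt:
  assumes "finite S" "x \<in> S" "y \<in> S" "x < y"
  shows "prv S (nxt S x) = x"
proof -
  note nx = nxt_props[OF assms(1,3,4)]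
  note pr = prv_props[OF assms(1,2) nx(2)]
  show ?thesis using nxt_props(3)[OF assms(1) pr(1), of x] pr nx by linarith
qed

lemma nxt_prv:
  assumes "finite S" "x \<in> S" "y \<in> S" "y < x"
  shows "nxt S (prv S x) = x"
proof -
  note pr = prv_props[OF assms(1,3,4)]
  note nx = nxt_props[OF assms(1,2) pr(2)]
  show ?thesis using prv_props(3)[OF assms(1) nx(1), of x] pr nx by linarith
qed

lemma nxt_less_nxt:
  assumes "finite S" "x \<in> S" "y \<in> S" "x < y" "z \<in> S" "y < z"
  shows "nxt S x < nxt S y"
  using nxt_props(3)[OF assms(1,3,4)] nxt_props(2)[OF assms(1,5,6)] by linarith

context one_neg begin

text \<open>\<open>u\<close> is included although its 1 is in column \<open>q\<close>: it is the top
  row of the block displaced by \<open>V\<close>, to which the highest left 1 is raised.\<close>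

definition lefts :: "nat set" where "lefts = insert u {i \<in> {u<..p}. f i < q}"
text \<open>\<open>c\<close> is included as the last column of the block displaced by
  \<open>H\<close>, the target of the last shift; \<open>q\<close> belongs to the set because of row
  \<open>m\<close>.\<close>

definition act :: "nat set" where "act = insert c {j \<in> {q..c}. j \<in> f ` {p<..n}}"
definition shift :: "nat \<Rightarrow> nat" where "shift x = (if x \<in> {q..<c} then nxt act x else x)"
text \<open>Lowering comes after \<open>V\<close>, so for \<open>u < i \<le> p\<close> row
  \<open>i\<close> receives what \<open>V\<close> left in row \<open>i - 1\<close>: a raised left 1
  if \<open>i - 1\<close> is in \<open>lefts\<close>, otherwise the right 1 of row
  \<open>i - 1\<close>.\<close>

definition dperm :: "nat \<Rightarrow> nat" where
  "dperm i = (if i \<le> u then f i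
     else if i \<le> p then (if i - 1 \<in> lefts then f (nxt lefts (i - 1)) else f (i - 1))
     else shift (f i))"

lemma finite_lefts: "finite lefts" and p_lefts: "p \<in> lefts" and u_lefts: "u \<in> lefts"
  and lefts_le: "i \<in> lefts \<Longrightarrow> i \<le> p"
  and lefts_iff: "u < i \<Longrightarrow> i \<le> p \<Longrightarrow> i \<in> lefts \<longleftrightarrow> f i < q"
  using rows cols by (auto simp: lefts_def)

lemma finite_act: "finite act" and c_act: "c \<in> act" and q_act: "q \<in> act"
  and act_ge: "x \<in> act \<Longrightarrow> q \<le> x" and act_le: "x \<in> act \<Longrightarrow> x \<le> c"
  using rows cols f_m by (auto simp: act_def intro: rev_image_eqI)

lemma act_f: "x \<in> act \<Longrightarrow> x \<noteq> c \<Longrightarrow> \<exists>i\<in>{p<..n}. f i = x"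
  by (auto simp: act_def)

lemma f_act: "i \<in> {p<..n} \<Longrightarrow> q \<le> f i \<Longrightarrow> f i < c \<Longrightarrow> f i \<in> act"
  by (auto simp: act_def)

lemma c_notin_below: "c \<notin> f ` {p<..n}"
proof
  assume "c \<in> f ` {p<..n}"
  then obtain k where "k \<in> {p<..n}" "f k = c" by (metis imageE)
  then show False using f_neq_c[of k] rows by simp
qed

lemma shift_f:
  assumes "i \<in> {p<..n}" "q \<le> f i" "f i < c"
  shows "shift (f i) \<in> act" "f i < shift (f i)" "shift (f i) \<le> c" "prv act (shift (f i)) = f i"
  using nxt_props[OF finite_act c_act assms(3)] prv_nxt[OF finite_act f_act[OF assms] c_act assms(3)] assms
  by (auto simp: shift_def)

lemma shift_id: "x < q \<or> c \<le> x \<Longrightarrow> shift x = x"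
  by (auto simp: shift_def)

text \<open>No row below \<open>p\<close> has its 1 in column \<open>c\<close>, so the nonzero
  columns of the block are \<open>act\<close> without \<open>c\<close>. An active column
  \<open>j\<close> beyond \<open>q\<close> receives column \<open>prv act j\<close>, and
  \<open>prv act\<close> inverts \<open>shift\<close> there.\<close>

lemma delta_shift:
  assumes "i \<in> {p<..n}" "j \<in> {1..n}"
  defines "M \<equiv> (\<lambda>i j. if i = p \<and> (j = q \<or> j = c) then 0 else A i j)"
  shows "hdisp M {p<..n} q c i j = of_bool (j = shift (f i))"
proof -
  have i: "i \<in> {1..n}" using assms rows by auto
  have M: "M i j = of_bool (j = f i)" if "i \<in> {p<..n}" "j \<in> {1..n}" for i j
    using that rows by (simp add: M_def row_other)
  have NZ: "{j' \<in> {q..c}. \<exists>i' \<in> {p<..n}. M i' j' \<noteq> 0} = act - {c}"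
  proof -
    have "(\<exists>i'\<in>{p<..n}. M i' j' \<noteq> 0) \<longleftrightarrow> j' \<in> f ` {p<..n}" if "j' \<in> {q..c}" for j'
      using that cols c_le M[of _ j'] by (auto simp: image_iff)
    then show ?thesis using c_notin_below by (auto simp: act_def)
  qed
  show ?thesis
  proof (cases "j \<in> {q..c}")
    case False
    have "hdisp M {p<..n} q c i j = of_bool (j = f i)"
      using False M[OF assms(1,2)] by (auto simp: hdisp_def)
    moreover have "j = f i \<longleftrightarrow> j = shift (f i)"
    proof (cases "q \<le> f i \<and> f i < c")
      case True
      then show ?thesis using shift_f[OF assms(1)] False by auto
    next
      case False
      then show ?thesis using shift_id by auto
    qed
    ultimately show ?thesis by simp
  next
    case True
    have pr: "{j' \<in> act - {c}. j' < j} = {j' \<in> act. j' < j}" using True by auto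
    have "hdisp M {p<..n} q c i j = (if j \<in> act \<and> q < j then M i (prv act j) else 0)"
    proof -
      have "(\<exists>j' \<in> act - {c}. j' < j) \<longleftrightarrow> q < j" using q_act cols act_ge by force
      moreover have "j \<in> act - {c} \<or> j = c \<longleftrightarrow> j \<in> act" using c_act by auto
      ultimately show ?thesis using True assms(1) by (simp only: hdisp_def NZ Let_def pr prv_def) auto
    qed
    also have "\<dots> = of_bool (j = shift (f i))"
    proof (cases "j \<in> act \<and> q < j")
      case True
      note pv = prv_props[OF finite_act q_act, of j]
      have "prv act j \<in> {1..n}" "prv act j < c" using pv True act_ge act_le[of j] c_le cols by fastforce+
      then have "M i (prv act j) = of_bool (prv act j = f i)" using M assms by blast
      moreover have "prv act j = f i \<longleftrightarrow> j = shift (f i)"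
      proof
        assume "prv act j = f i"
        then show "j = shift (f i)"
          using nxt_prv[OF finite_act _ q_act, of j] True act_ge[of "f i"] pv \<open>prv act j < c\<close>
          by (simp add: shift_def)
      next
        assume j: "j = shift (f i)"
        have "q \<le> f i \<and> f i < c"
          using j True act_le[of j] f_neq_c[OF i] shift_id[of "f i"] by fastforce
        then show "prv act j = f i" using shift_f[OF assms(1)] j by auto
      qed
      ultimately show ?thesis using True by simp
    next
      case False
      have "j \<noteq> shift (f i)"
      proof (cases "q \<le> f i \<and> f i < c")
        case True
        then show ?thesis using shift_f[OF assms(1)] False by auto
      next
        case False
        then have "f i < q \<or> c < f i" using f_neq_c[OF i] by fastforce
        then show ?thesis using shift_id[of "f i"] \<open>j \<in> {q..c}\<close> by auto
      qed
      then show ?thesis using False by auto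
    qed
    finally show ?thesis .
  qed
qed

lemma delta_eq: "delta n A i j = (if i \<in> {1..n} \<and> j \<in> {1..n} then of_bool (j = dperm i) else 0)"
proof -
  define M1 where "M1 = (\<lambda>i j. if i = p \<and> (j = q \<or> j = c) then 0 else A i j)"
  define M2 where "M2 = hdisp M1 {p<..n} q c"
  define M3 where "M3 = vdisp M2 {1..<q} u p"
  have delta: "delta n A i j = (if j \<in> {1..<q} \<and> u \<le> i \<and> i \<le> p then (if i = u then 0 else M3 (i - 1) j)
      else if j \<in> {q<..n} \<and> u + 1 \<le> i \<and> i \<le> p then (if i = u + 1 then 0 else M3 (i - 1) j)
      else M3 i j)" for i j
    unfolding delta_def Let_def open_row_eq clos_row_eq open_col_eq clos_col_eq M3_def M2_def M1_def ..
  have out: "A i j = 0" if "\<not> (i \<in> {1..n} \<and> j \<in> {1..n})" for i j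
    using that by (subst entry) (simp only: if_False)
  have M1: "M1 i j = of_bool (j = f i)" if "i \<in> {1..n}" "j \<in> {1..n}" for i j
    using that cols by (cases "i = p") (auto simp: M1_def row_other row_p)
  have M2_low: "M2 i j = of_bool (j = shift (f i))" if "i \<in> {p<..n}" "j \<in> {1..n}" for i j
    using delta_shift[OF that] by (simp add: M2_def M1_def)
  have M2_high: "M2 i j = M1 i j" if "i \<notin> {p<..n}" for i j
    using that by (auto simp: M2_def hdisp_def)
  \<comment> \<open>Row \<open>u\<close> has no 1 in the left side, so \<open>V\<close> does not
    count it among the nonzero rows; it enters only as the first row of the block.\<close>
  have NZ: "{i' \<in> {u..p}. \<exists>j' \<in> {1..<q}. M2 i' j' \<noteq> 0} = lefts - {u}"
  proof -
    have "(\<exists>j' \<in> {1..<q}. M2 i' j' \<noteq> 0) \<longleftrightarrow> f i' < q" if "i' \<in> {u..p}" for i'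
    proof -
      have i': "i' \<in> {1..n}" using that rows by auto
      have "M2 i' j' = of_bool (j' = f i')" if "j' \<in> {1..<q}" for j'
        using \<open>i' \<in> {u..p}\<close> that i' cols c_le by (subst M2_high) (auto simp: M1)
      then show ?thesis using f_range[OF i'] by auto
    qed
    then have "{i' \<in> {u..p}. \<exists>j' \<in> {1..<q}. M2 i' j' \<noteq> 0} = {i' \<in> {u..p}. f i' < q}" by blast
    also have "\<dots> = lefts - {u}" using f_u by (auto simp: lefts_def le_less)
    finally show ?thesis .
  qed
  have M3_out: "M3 i j = M2 i j" if "\<not> (i \<in> {u..p} \<and> j \<in> {1..<q})" for i j
    unfolding M3_def vdisp_def using that by (simp only: if_False)
  have M3_in: "M3 i j = of_bool (i \<in> lefts \<and> j = f (nxt lefts i))" if "i \<in> {u..<p}" "j \<in> {1..<q}" for i j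
  proof -
    have "{i' \<in> lefts - {u}. i < i'} = {i' \<in> lefts. i < i'}" using that by auto
    moreover have "\<exists>i' \<in> lefts - {u}. i < i'" using that p_lefts by force
    moreover have "i \<in> lefts - {u} \<or> i = u \<longleftrightarrow> i \<in> lefts" using u_lefts by auto
    ultimately have *: "M3 i j = (if i \<in> lefts then M2 (nxt lefts i) j else 0)"
      using that by (simp only: M3_def vdisp_def NZ Let_def nxt_def) auto
    show ?thesis
    proof (cases "i \<in> lefts")
      case True
      have "nxt lefts i \<in> lefts" "i < nxt lefts i" "nxt lefts i \<le> p"
        using nxt_props[OF finite_lefts p_lefts, of i] that by auto
      then have "M2 (nxt lefts i) j = of_bool (j = f (nxt lefts i))"
        using that rows cols c_le by (subst M2_high) (auto simp: M1)
      then show ?thesis using * True by simp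
    qed (use * in simp)
  qed
  show ?thesis
  proof (cases "i \<in> {1..n} \<and> j \<in> {1..n}")
    case False
    have "M3 i j = 0" using False rows cols c_le M3_out[of i j] M2_high[of i j] out[of i j]
      by (auto simp: M2_def hdisp_def M1_def)
    then show ?thesis using False rows cols c_le by (auto simp: delta)
  next
    case True
    then have i: "i \<in> {1..n}" and j: "j \<in> {1..n}" by auto
    consider "i < u" | "i = u" | "u < i" "i \<le> p" | "p < i" by linarith
    then have "delta n A i j = of_bool (j = dperm i)"
    proof cases
      case 1
      then show ?thesis using rows M3_out[of i j] M2_high[of i j] M1[OF i j] by (simp add: delta dperm_def)
    next
      case 2
      then show ?thesis using rows M3_out[of i j] M2_high[of i j] M1[OF i j] f_u j by (auto simp: delta dperm_def)
    next
      case 3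
      have i1: "i - 1 \<in> {u..<p}" "i - 1 \<in> {1..n}" using 3 i rows by auto
      have d: "dperm i = (if i - 1 \<in> lefts then f (nxt lefts (i - 1)) else f (i - 1))"
        using 3 by (simp add: dperm_def)
      have left: "f (nxt lefts (i - 1)) < q"
        using nxt_props[OF finite_lefts p_lefts, of "i - 1"] i1 lefts_iff[of "nxt lefts (i - 1)"] lefts_le
        by auto
      have right: "q < f (i - 1)" if "i - 1 \<notin> lefts"
        using that i1 lefts_iff[of "i - 1"] f_eq_q[of "i - 1"] u_lefts rows
        by (cases "i - 1 = u") (auto simp: not_less le_less)
      consider "j < q" | "j = q" | "q < j" by linarith
      then show ?thesis
      proof cases
        case 1
        then have "delta n A i j = of_bool (i - 1 \<in> lefts \<and> j = f (nxt lefts (i - 1)))"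
          using 3 j M3_in[OF i1(1), of j] by (simp add: delta)
        then show ?thesis using right d 1 by auto
      next
        case 2
        then have "delta n A i j = M1 i q" using 3 j M3_out[of i j] M2_high[of i j] by (simp add: delta)
        also have "\<dots> = 0" using 3 f_eq_q[OF i] M1[OF i, of q] j 2 rows by auto
        finally show ?thesis using left right d 2 by auto
      next
        case 3
        show ?thesis
        proof (cases "i = u + 1")
          case True
          then show ?thesis using 3 j rows left d u_lefts by (auto simp: delta)
        next
          case False
          then have "delta n A i j = M1 (i - 1) j"
            using 3 \<open>u < i\<close> \<open>i \<le> p\<close> j M3_out[of "i - 1" j] M2_high[of "i - 1" j] by (auto simp: delta)
          then show ?thesis
            using M1[OF i1(2) j] left d 3 False lefts_iff[of "i - 1"] i1 \<open>u < i\<close> by auto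
        qed
      qed
    next
      case 4
      then show ?thesis using i j M3_out[of i j] M2_low[of i j] rows by (auto simp: delta dperm_def)
    qed
    then show ?thesis using True by simp
  qed
qed

end

section \<open>Inversions of the discharged permutation\<close>

lemma card_bij_less:
  assumes "bij_betw g {1..n} {1..n}" "x \<in> {1..n}"
  shows "card {k \<in> {1..n}. g k < x} = x - 1"
proof -
  have "g ` {k \<in> {1..n}. g k < x} = {1..<x}"
  proof
    show "g ` {k \<in> {1..n}. g k < x} \<subseteq> {1..<x}" using bij_betwE[OF assms(1)] by auto
    show "{1..<x} \<subseteq> g ` {k \<in> {1..n}. g k < x}"
    proof
      fix y assume y: "y \<in> {1..<x}"
      then have "y \<in> g ` {1..n}" using assms by (simp add: bij_betw_def)
      then show "y \<in> g ` {k \<in> {1..n}. g k < x}" using y by auto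
    qed
  qed
  moreover have "inj_on g {k \<in> {1..n}. g k < x}"
    using bij_betw_imp_inj_on[OF assms(1)] by (rule inj_on_subset) auto
  ultimately show ?thesis by (metis card_atLeastLessThan card_image)
qed

lemma card_split: "i \<le> (n::nat) \<Longrightarrow> card {k \<in> {1..n}. P k} = card {k \<in> {1..i}. P k} + card {k \<in> {i<..n}. P k}"
  by (subst card_Un_disjoint[symmetric]) (auto intro!: arg_cong[where f = card])

context one_neg begin

text \<open>The new row of the 1 at \<open>(i, f i)\<close> for \<open>u < i \<le> p\<close>: a left
  1 is raised to the previous member of \<open>lefts\<close> and then lowered by one, a right 1 is
  only lowered.\<close>

definition phi :: "nat \<Rightarrow> nat" where
  "phi i = (if f i < q then Suc (prv lefts i) else Suc i)"

lemma f_enclosed: "u < i \<Longrightarrow> i \<le> p \<Longrightarrow> f i \<noteq> q"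
  using f_eq_q[of i] rows by auto

lemma prv_lefts:
  assumes "u < i" "i \<le> p" "f i < q"
  shows "prv lefts i \<in> lefts" "u \<le> prv lefts i" "prv lefts i < i" "nxt lefts (prv lefts i) = i"
  using prv_props[OF finite_lefts u_lefts, of i] nxt_prv[OF finite_lefts _ u_lefts, of i]
    lefts_iff[of i] assms by auto

text \<open>Lowering a right 1 stays within the range because row \<open>p\<close> is a left
  row.\<close>

lemma phi_range: "u < i \<Longrightarrow> i \<le> p \<Longrightarrow> u < phi i \<and> phi i \<le> p"
  using prv_lefts[of i] f_enclosed[of i] cols by (cases "i = p") (auto simp: phi_def)

lemma dperm_phi:
  assumes "u < i" "i \<le> p"
  shows "dperm (phi i) = f i"
proof (cases "f i < q")
  case True
  then show ?thesis using prv_lefts[OF assms True] phi_range[OF assms] by (simp add: dperm_def phi_def)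
next
  case False
  then show ?thesis using phi_range[OF assms] lefts_iff[OF assms] assms by (simp add: dperm_def phi_def)
qed

text \<open>\<open>f\<close> repeats a value only at \<open>u\<close> and \<open>m\<close>; the rows
  \<open>{u<..p}\<close> contain neither of them, the rows below \<open>p\<close> only
  \<open>m\<close>.\<close>

lemma f_inj_enclosed: "inj_on f {u<..p}"
proof (rule inj_onI)
  fix x y assume "x \<in> {u<..p}" "y \<in> {u<..p}" "f x = f y"
  then show "x = y" using f_eq[of x y] rows by auto
qed

lemma f_inj_below: "inj_on f {p<..n}"
proof (rule inj_onI)
  fix x y assume "x \<in> {p<..n}" "y \<in> {p<..n}" "f x = f y"
  then show "x = y" using f_eq[of x y] f_eq_q[of x] f_eq_q[of y] f_m rows by force
qed

lemma phi_inj: "inj_on phi {u<..p}"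
proof (rule inj_onI)
  fix x y assume xy: "x \<in> {u<..p}" "y \<in> {u<..p}" "phi x = phi y"
  then have "f x = f y" using dperm_phi[of x] dperm_phi[of y] by simp
  then show "x = y" using xy f_inj_enclosed by (auto dest: inj_onD)
qed

lemma phi_image: "phi ` {u<..p} = {u<..p}"
  by (rule card_subset_eq) (use phi_range in \<open>auto simp: card_image[OF phi_inj]\<close>)

lemma shift_strict_mono:
  assumes i: "i \<in> {p<..n}" and k: "k \<in> {p<..n}" and less: "f i < f k"
  shows "shift (f i) < shift (f k)"
proof -
  have "f k \<noteq> c" "f i \<noteq> c" using f_neq_c i k rows by auto
  then consider "f i < q" "q \<le> f k" "f k < c" | "f i < q" "f k < q \<or> c < f k"
    | "q \<le> f i" "f i < c" "f k < c" | "q \<le> f i" "f i < c" "c < f k" | "c < f i" using less by linarith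
  then show ?thesis
  proof cases
    case 1 then show ?thesis using shift_f[OF k] shift_id[of "f i"] by simp
  next
    case 2 then show ?thesis using shift_id[of "f i"] shift_id[of "f k"] less by auto
  next
    case 3 then show ?thesis
      using nxt_less_nxt[OF finite_act f_act[OF i] f_act[OF k] less c_act] less by (simp add: shift_def)
  next
    case 4 then show ?thesis using shift_f[OF i] shift_id[of "f k"] by simp
  next
    case 5 then show ?thesis using shift_id[of "f i"] shift_id[of "f k"] less by simp
  qed
qed

lemma shift_less_iff:
  assumes "i \<in> {p<..n}" "k \<in> {p<..n}"
  shows "shift (f i) < shift (f k) \<longleftrightarrow> f i < f k"
  using shift_strict_mono[OF assms] shift_strict_mono[OF assms(2,1)]
  by (metis less_asym linorder_neqE_nat)

lemma shift_inj: "inj_on shift (f ` {p<..n})"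
  by (rule inj_onI) (metis imageE less_irrefl shift_less_iff linorder_neqE_nat)

text \<open>Each active column moves to the next one, so as a set only the first, \<open>q\<close>,
  is vacated and only the last, \<open>c\<close>, is filled.\<close>

lemma shift_image: "shift ` f ` {p<..n} = insert c (f ` {p<..n} - {q})"
proof
  show "shift ` f ` {p<..n} \<subseteq> insert c (f ` {p<..n} - {q})"
  proof
    fix x assume "x \<in> shift ` f ` {p<..n}"
    then obtain i where i: "i \<in> {p<..n}" "x = shift (f i)" by auto
    show "x \<in> insert c (f ` {p<..n} - {q})"
    proof (cases "q \<le> f i \<and> f i < c")
      case True
      then show ?thesis using shift_f[OF i(1)] act_f[of x] i by force
    next
      case False
      then show ?thesis using shift_id[of "f i"] i cols by auto
    qed
  qed
  show "insert c (f ` {p<..n} - {q}) \<subseteq> shift ` f ` {p<..n}"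
  proof
    fix x assume x: "x \<in> insert c (f ` {p<..n} - {q})"
    show "x \<in> shift ` f ` {p<..n}"
    proof (cases "x \<in> act")
      case True
      have "q < x" using x True act_ge[of x] cols by auto
      note pv = prv_props[OF finite_act q_act this]
      have "prv act x < c" using pv act_le[OF True] by simp
      then obtain i where i: "i \<in> {p<..n}" "f i = prv act x" using act_f[OF pv(1)] by auto
      have "shift (prv act x) = x" using nxt_prv[OF finite_act True q_act \<open>q < x\<close>] pv \<open>prv act x < c\<close>
        by (simp add: shift_def)
      then show ?thesis using i by (metis imageI)
    next
      case False
      then have "x \<noteq> c" using c_act by blast
      then obtain i where i: "i \<in> {p<..n}" "x = f i" "x \<noteq> c" using x by blast
      then have "shift x = x" using False f_act[of i] by (intro shift_id) (use not_less in blast)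
      then show ?thesis using i by (metis imageI)
    qed
  qed
qed

lemma dperm_range: "i \<in> {1..n} \<Longrightarrow> dperm i \<in> {1..n}"
proof -
  assume i: "i \<in> {1..n}"
  consider "i \<le> u" | "u < i" "i \<le> p" | "p < i" by linarith
  then show ?thesis
  proof cases
    case 1 then show ?thesis using f_range[OF i] by (simp add: dperm_def)
  next
    case 2
    then have "i \<in> phi ` {u<..p}" using phi_image by simp
    then obtain k where "k \<in> {u<..p}" "i = phi k" by blast
    then show ?thesis using dperm_phi[of k] f_range[of k] rows by simp
  next
    case 3
    then have "dperm i \<in> shift ` f ` {p<..n}" using i rows by (auto simp: dperm_def)
    then have "dperm i = c \<or> dperm i \<in> f ` {p<..n}" using shift_image by auto
    moreover have "f ` {p<..n} \<subseteq> {1..n}" using f_range rows by fastforce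
    ultimately show ?thesis using c_le cols by auto
  qed
qed

lemma dperm_bij: "bij_betw dperm {1..n} {1..n}"
proof -
  have "j \<in> dperm ` {1..n}" if j: "j \<in> {1..n}" for j
  proof (cases "j \<in> shift ` f ` {p<..n}")
    case True
    then obtain i where "i \<in> {p<..n}" "j = shift (f i)" by blast
    then show ?thesis using rows by (intro image_eqI[of _ _ i]) (auto simp: dperm_def)
  next
    case False
    then have "j \<noteq> c" "j = q \<or> j \<notin> f ` {p<..n}" using shift_image by auto
    then obtain i where i: "i \<in> {1..n}" "i \<noteq> m" "f i = j" using f_surj[OF j] by auto
    have "i \<le> p"
    proof (rule ccontr)
      assume "\<not> i \<le> p"
      then have "j = q" using i \<open>j = q \<or> j \<notin> f ` {p<..n}\<close> by auto
      then show False using f_eq_q[OF i(1)] i \<open>\<not> i \<le> p\<close> rows by auto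
    qed
    show ?thesis
    proof (cases "i \<le> u")
      case True then show ?thesis using i by (intro image_eqI[of _ _ i]) (auto simp: dperm_def)
    next
      case False
      then show ?thesis using i dperm_phi[of i] phi_range[of i] \<open>i \<le> p\<close> rows
        by (intro image_eqI[of _ _ "phi i"]) auto
    qed
  qed
  then have "dperm ` {1..n} = {1..n}" using dperm_range by blast
  then show ?thesis by (simp add: bij_betw_def eq_card_imp_inj_on)
qed

text \<open>The sum of the entries strictly below row \<open>i\<close> and strictly left of column
  \<open>x\<close>, as \<open>sw_eq\<close> confirms; the correction is present when row
  \<open>p\<close> lies below row \<open>i\<close>. The values at \<open>x = f i\<close> form the
  inversion table.\<close>

definition sw :: "nat \<Rightarrow> nat \<Rightarrow> int" where
  "sw i x = int (card {k \<in> {i<..n}. f k < x}) + of_bool (i < p) * (of_bool (c < x) - of_bool (q < x))"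

text \<open>The correction replaces the value \<open>q\<close> of \<open>f\<close> at
  \<open>m\<close> by \<open>c\<close>, so this is a count for a permutation: each of the
  \<open>x - 1\<close> columns has sum 1.\<close>

lemma sw_total:
  assumes "x \<in> {1..n}"
  shows "int (card {k \<in> {1..n}. f k < x}) + of_bool (c < x) - of_bool (q < x) = int x - 1"
proof -
  let ?g = "f(m := c)"
  have m: "m \<in> {1..n}" using rows by auto
  have split: "int (card {k \<in> {1..n}. h k < x}) = int (card {k \<in> {1..n} - {m}. h k < x}) + of_bool (h m < x)"
    for h :: "nat \<Rightarrow> nat"
  proof -
    have "{k \<in> {1..n}. h k < x} = {k \<in> {1..n} - {m}. h k < x} \<union> (if h m < x then {m} else {})"
      using m by auto
    then show ?thesis by (simp add: card_Un_disjoint)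
  qed
  have "{k \<in> {1..n} - {m}. ?g k < x} = {k \<in> {1..n} - {m}. f k < x}" by auto
  then show ?thesis using split[of ?g] split[of f] f_m card_bij_less[OF bij assms] assms by simp
qed

text \<open>Passing to the complement leaves only rows up to \<open>i\<close>, where
  \<open>f\<close> and \<open>dperm\<close> agree. Rows down to the opening row thus need no
  analysis of the displacements below them.\<close>

lemma sw_high:
  assumes "i \<in> {1..n}" "i \<le> u"
  shows "sw i (f i) = int (f i) - 1 - int (card {k \<in> {1..i}. f k < f i})"
  using sw_total[OF f_range[OF assms(1)]] card_split[of i n "\<lambda>k. f k < f i"] assms rows
  by (simp add: sw_def)

definition inv_dperm :: "nat \<Rightarrow> nat" where
  "inv_dperm i = card {k \<in> {i<..n}. dperm k < dperm i}"

lemma inv_dperm_high: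
  assumes "i \<in> {1..n}" "i \<le> u"
  shows "int (inv_dperm i) = sw i (f i)"
proof -
  have d: "dperm i = f i" using assms by (simp add: dperm_def)
  have "{k \<in> {1..i}. dperm k < f i} = {k \<in> {1..i}. f k < f i}" using assms by (auto simp: dperm_def)
  moreover have "int (f i - 1) = int (f i) - 1" using f_range[OF assms(1)] by auto
  ultimately show ?thesis
    using sw_high[OF assms] card_bij_less[OF dperm_bij f_range[OF assms(1)]]
      card_split[of i n "\<lambda>k. dperm k < f i"] assms f_range[OF assms(1)]
    by (simp add: inv_dperm_def d of_nat_diff)
qed

lemma inv_dperm_low:
  assumes "i \<in> {p<..n}"
  shows "int (inv_dperm i) = sw i (f i)"
proof -
  have "{k \<in> {i<..n}. dperm k < dperm i} = {k \<in> {i<..n}. f k < f i}"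
    using assms shift_less_iff[of _ i] rows by (auto simp: dperm_def)
  then show ?thesis using assms by (simp add: inv_dperm_def sw_def)
qed

lemma card_split_p:
  "i \<le> p \<Longrightarrow> card {k \<in> {i<..n}. P k} = card {k \<in> {i<..p}. P k} + card {k \<in> {p<..n}. P k}"
  using rows by (subst card_Un_disjoint[symmetric]) (auto intro!: arg_cong[where f = card])

lemma phi_image_Collect:
  assumes "\<And>k. u < k \<Longrightarrow> k \<le> p \<Longrightarrow> P (phi k) \<longleftrightarrow> Q k"
  shows "card {k \<in> {u<..p}. P k} = card {k \<in> {u<..p}. Q k}"
proof -
  have "{k \<in> {u<..p}. P k} = phi ` {k \<in> {u<..p}. Q k}"
  proof
    show "{k \<in> {u<..p}. P k} \<subseteq> phi ` {k \<in> {u<..p}. Q k}"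
    proof
      fix k assume k: "k \<in> {k \<in> {u<..p}. P k}"
      then have "k \<in> phi ` {u<..p}" using phi_image by simp
      then obtain k' where "k' \<in> {u<..p}" "k = phi k'" by blast
      then show "k \<in> phi ` {k \<in> {u<..p}. Q k}" using k assms[of k'] by auto
    qed
    show "phi ` {k \<in> {u<..p}. Q k} \<subseteq> {k \<in> {u<..p}. P k}" using assms phi_range by auto
  qed
  moreover have "inj_on phi {k \<in> {u<..p}. Q k}" using phi_inj by (rule inj_on_subset) auto
  ultimately show ?thesis by (simp add: card_image)
qed

lemma phi_less_left:
  assumes "u < i" "i \<le> p" "f i < q" "u < k" "k \<le> p" "f k < q"
  shows "phi i < phi k \<longleftrightarrow> i < k"
proof -
  have "prv lefts i < prv lefts k" if "u < i" "i < k" "k \<le> p" "f i < q" "f k < q" for i k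
    using prv_props(3)[OF finite_lefts, of i k] lefts_iff[of i] prv_lefts[of i] that by auto
  from this[of i k] this[of k i] show ?thesis using assms by (cases i k rule: linorder_cases) (auto simp: phi_def)
qed

text \<open>Only columns left of \<open>q\<close> count here. Left 1s keep their relative order
  under \<open>phi\<close>, \<open>shift\<close> fixes these columns, and the corrections at
  \<open>q\<close> and \<open>c\<close> vanish.\<close>

lemma inv_dperm_left:
  assumes "u < i" "i \<le> p" "f i < q"
  shows "int (inv_dperm (phi i)) = sw i (f i)"
proof -
  note ph = phi_range[OF assms(1,2)]
  have 1: "{k \<in> {p<..n}. dperm k < f i} = {k \<in> {p<..n}. f k < f i}"
  proof -
    have "dperm k < f i \<longleftrightarrow> f k < f i" if k: "k \<in> {p<..n}" for k
    proof (cases "q \<le> f k \<and> f k < c")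
      case True
      then show ?thesis using shift_f[OF k] k assms rows by (auto simp: dperm_def)
    next
      case False
      then show ?thesis using shift_id[of "f k"] k rows by (auto simp: dperm_def)
    qed
    then show ?thesis by auto
  qed
  have 2: "card {k \<in> {u<..p}. phi i < k \<and> dperm k < f i} = card {k \<in> {u<..p}. i < k \<and> f k < f i}"
    by (rule phi_image_Collect) (use phi_less_left[OF assms] dperm_phi assms in auto)
  have "{k \<in> {phi i<..p}. dperm k < f i} = {k \<in> {u<..p}. phi i < k \<and> dperm k < f i}"
    "{k \<in> {i<..p}. f k < f i} = {k \<in> {u<..p}. i < k \<and> f k < f i}"
    using ph assms by auto
  then have "inv_dperm (phi i) = card {k \<in> {i<..n}. f k < f i}"
    using 1 2 card_split_p[of "phi i" "\<lambda>k. dperm k < f i"] card_split_p[of i "\<lambda>k. f k < f i"] ph assms(2)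
    unfolding inv_dperm_def dperm_phi[OF assms(1,2)] by (simp only:)
  then show ?thesis using assms cols by (simp add: sw_def)
qed

text \<open>Every left 1 ends just below its predecessor in \<open>lefts\<close>. Of the left 1s
  below row \<open>i\<close>, only the first has its predecessor above row \<open>i\<close>, so it
  alone passes the lowered right 1; right 1s move down together.\<close>

lemma phi_right_iff:
  assumes "u < i" "i \<le> p" "q < f i" "u < k" "k \<le> p"
  shows "Suc i < phi k \<longleftrightarrow> i < k \<and> k \<noteq> nxt lefts i"
proof -
  have "i < p" using assms cols by (cases "i = p") auto
  note nx = nxt_props[OF finite_lefts p_lefts this]
  have nl: "f (nxt lefts i) < q" using nx assms lefts_iff[of "nxt lefts i"] by auto
  show ?thesis
  proof (cases "f k < q")
    case True
    then have k: "k \<in> lefts" using lefts_iff assms by auto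
    note pk = prv_lefts[OF assms(4,5) True]
    have "i < prv lefts k \<longleftrightarrow> i < k \<and> k \<noteq> nxt lefts i"
    proof
      assume *: "i < prv lefts k"
      then have "nxt lefts i \<le> prv lefts k" by (rule nxt_props(3)[OF finite_lefts pk(1)])
      then show "i < k \<and> k \<noteq> nxt lefts i" using pk(3) * by auto
    next
      assume *: "i < k \<and> k \<noteq> nxt lefts i"
      then have "nxt lefts i < k" using nxt_props(3)[OF finite_lefts k, of i] by auto
      then show "i < prv lefts k" using prv_props(3)[OF finite_lefts nx(1), of k] nx by auto
    qed
    then show ?thesis using True by (simp add: phi_def)
  next
    case False
    then show ?thesis using nl by (auto simp: phi_def)
  qed
qed

text \<open>Below row \<open>p\<close> the set of columns exchanges \<open>q\<close> for
  \<open>c\<close>, which matches the correction in \<open>sw\<close>. The loss of one is the 1 of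
  row \<open>nxt lefts i\<close>, which lies left of \<open>q\<close> and is raised past row
  \<open>Suc i\<close>.\<close>

lemma inv_dperm_right:
  assumes "u < i" "i < p" "q < f i"
  shows "int (inv_dperm (phi i)) = sw i (f i) - 1"
proof -
  let ?F = "f ` {p<..n}" and ?x = "f i"
  have phi: "phi i = Suc i" using assms by (simp add: phi_def)
  have 1: "int (card {k \<in> {p<..n}. dperm k < ?x}) = int (card {k \<in> {p<..n}. f k < ?x}) + of_bool (c < ?x) - 1"
  proof -
    have "card {k \<in> {p<..n}. f k < ?x} = card (?F \<inter> {..<?x})"
    proof -
      have "inj_on f {k \<in> {p<..n}. f k < ?x}" using f_inj_below by (rule inj_on_subset) auto
      then have "card (f ` {k \<in> {p<..n}. f k < ?x}) = card {k \<in> {p<..n}. f k < ?x}" by (rule card_image)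
      moreover have "f ` {k \<in> {p<..n}. f k < ?x} = ?F \<inter> {..<?x}" by blast
      ultimately show ?thesis by (simp only:)
    qed
    moreover have "card {k \<in> {p<..n}. dperm k < ?x} = card (insert c (?F - {q}) \<inter> {..<?x})"
    proof -
      have "inj_on (shift \<circ> f) {p<..n}" using f_inj_below shift_inj by (rule comp_inj_on)
      then have "inj_on (shift \<circ> f) {k \<in> {p<..n}. shift (f k) < ?x}" by (rule inj_on_subset) auto
      then have "card ((shift \<circ> f) ` {k \<in> {p<..n}. shift (f k) < ?x}) = card {k \<in> {p<..n}. shift (f k) < ?x}"
        by (rule card_image)
      moreover have "(shift \<circ> f) ` {k \<in> {p<..n}. shift (f k) < ?x} = shift ` ?F \<inter> {..<?x}" by force
      ultimately have "card {k \<in> {p<..n}. shift (f k) < ?x} = card (shift ` ?F \<inter> {..<?x})"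
        by (simp only:)
      moreover have "{k \<in> {p<..n}. dperm k < ?x} = {k \<in> {p<..n}. shift (f k) < ?x}"
        using rows by (auto simp: dperm_def)
      ultimately show ?thesis by (simp only: shift_image)
    qed
    moreover have "int (card (insert c (?F - {q}) \<inter> {..<?x})) = int (card (?F \<inter> {..<?x})) + of_bool (c < ?x) - 1"
    proof -
      have q: "q \<in> ?F \<inter> {..<?x}" using f_m rows assms by (auto intro: rev_image_eqI)
      note c = c_notin_below
      have "insert c (?F - {q}) \<inter> {..<?x} = (?F \<inter> {..<?x} - {q}) \<union> (if c < ?x then {c} else {})" by auto
      moreover have "card (?F \<inter> {..<?x}) > 0" using q card_gt_0_iff by blast
      ultimately show ?thesis using q c by (simp add: card_Diff_singleton)
    qed
    ultimately show ?thesis by simp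
  qed
  have ip: "i < p" by fact
  note nx = nxt_props[OF finite_lefts p_lefts ip]
  have nl: "f (nxt lefts i) < q" using nx assms lefts_iff[of "nxt lefts i"] by auto
  have 2: "card {k \<in> {u<..p}. Suc i < k \<and> dperm k < ?x}
      = card {k \<in> {u<..p}. i < k \<and> k \<noteq> nxt lefts i \<and> f k < ?x}"
    by (rule phi_image_Collect) (use phi_right_iff[of i] assms dperm_phi in auto)
  have 3: "{k \<in> {u<..p}. i < k \<and> k \<noteq> nxt lefts i \<and> f k < ?x} = {k \<in> {i<..p}. f k < ?x} - {nxt lefts i}"
    using assms by auto
  have mem: "nxt lefts i \<in> {k \<in> {i<..p}. f k < ?x}" using nx nl assms by auto
  have 4: "{k \<in> {Suc i<..p}. dperm k < ?x} = {k \<in> {u<..p}. Suc i < k \<and> dperm k < ?x}"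
    using assms by auto
  have "card {k \<in> {i<..p}. f k < ?x} > 0" using mem card_gt_0_iff by fastforce
  then have "int (card {k \<in> {Suc i<..p}. dperm k < ?x}) = int (card {k \<in> {i<..p}. f k < ?x}) - 1"
    using 2 3 4 mem by (simp add: card_Diff_singleton)
  moreover have "inv_dperm (phi i)
      = card {k \<in> {Suc i<..p}. dperm k < ?x} + card {k \<in> {p<..n}. dperm k < ?x}"
    unfolding inv_dperm_def using dperm_phi[of i] assms unfolding phi by (subst card_split_p) auto
  moreover have "sw i ?x = int (card {k \<in> {i<..p}. f k < ?x} + card {k \<in> {p<..n}. f k < ?x})
      + of_bool (c < ?x) - 1"
    using assms card_split_p[of i "\<lambda>k. f k < ?x"] unfolding sw_def by simp
  ultimately show ?thesis using 1 by simp
qed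

lemma sum_sw:
  "(\<Sum>i\<in>{1..n}. sw i (f i)) = (\<Sum>i\<in>{1..n}. int (inv_dperm i)) + int (card {i \<in> {u<..<p}. q < f i})"
proof -
  have split: "{1..n} = {1..u} \<union> {u<..p} \<union> {p<..n}" using rows by auto
  have sum3: "(\<Sum>i\<in>{1..n}. g i) = (\<Sum>i\<in>{1..u}. g i) + (\<Sum>i\<in>{u<..p}. g i) + (\<Sum>i\<in>{p<..n}. g i)"
    for g :: "nat \<Rightarrow> int"
    using rows unfolding split by (subst sum.union_disjoint; (subst sum.union_disjoint)?) auto
  have 1: "(\<Sum>i\<in>{1..u}. int (inv_dperm i)) = (\<Sum>i\<in>{1..u}. sw i (f i))"
    by (rule sum.cong) (use inv_dperm_high rows in auto)
  have 2: "(\<Sum>i\<in>{p<..n}. int (inv_dperm i)) = (\<Sum>i\<in>{p<..n}. sw i (f i))"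
    by (rule sum.cong) (use inv_dperm_low rows in auto)
  have "(\<Sum>i\<in>{u<..p}. int (inv_dperm i)) = (\<Sum>i\<in>{u<..p}. int (inv_dperm (phi i)))"
    using sum.reindex[OF phi_inj, of "\<lambda>i. int (inv_dperm i)"] by (simp add: phi_image)
  also have "\<dots> = (\<Sum>i\<in>{u<..p}. sw i (f i) - of_bool (q < f i))"
  proof (rule sum.cong)
    fix i assume i: "i \<in> {u<..p}"
    show "int (inv_dperm (phi i)) = sw i (f i) - of_bool (q < f i)"
      using i inv_dperm_left[of i] inv_dperm_right[of i] f_enclosed[of i] cols
      by (cases "i = p"; cases "f i < q") auto
  qed simp
  also have "\<dots> = (\<Sum>i\<in>{u<..p}. sw i (f i)) - int (card {i \<in> {u<..<p}. q < f i})"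
  proof -
    have "{i \<in> {u<..p}. q < f i} = {i \<in> {u<..<p}. q < f i}" using cols by (auto simp: le_less)
    then show ?thesis by (simp add: sum_subtractf sum.If_cases of_bool_def Int_def)
  qed
  finally show ?thesis using 1 2 sum3[of "\<lambda>i. sw i (f i)"] sum3[of "\<lambda>i. int (inv_dperm i)"] by simp
qed

end

section \<open>Parameters and neutral matrices\<close>

text \<open>Ranks are injective and smaller than the size of the set, so by counting every rank
  occurs. This supplies a closing column of prescribed rank.\<close>

lemma ex_card_less:
  fixes X :: "nat set"
  assumes "finite X" "r < card X"
  shows "\<exists>y\<in>X. card {x \<in> X. x < y} = r"
proof -
  let ?h = "\<lambda>y. card {x \<in> X. x < y}"
  have less: "?h x < ?h y" if "x \<in> X" "x < y" for x y
    using assms(1) that by (intro psubset_card_mono) auto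
  have "inj_on ?h X"
  proof (rule inj_onI)
    fix x y assume "x \<in> X" "y \<in> X" "?h x = ?h y"
    then show "x = y" using less[of x y] less[of y x] by (cases x y rule: linorder_cases) auto
  qed
  then have "card (?h ` X) = card X" by (rule card_image)
  moreover have "?h y < card X" if "y \<in> X" for y
    using assms(1) that by (intro psubset_card_mono) auto
  then have "?h ` X \<subseteq> {..<card X}" by blast
  ultimately have "?h ` X = {..<card X}" by (simp add: card_subset_eq)
  then show ?thesis using assms(2) by (metis (no_types, lifting) imageE lessThan_iff)
qed

section \<open>Sums of entries and statistics as cardinalities\<close>

context one_neg begin

text \<open>The weight is kept general: weight 1 gives block and row sums, \<open>sw i\<close> gives
  inversions, and column sums below row \<open>i\<close> serve for the reflection.\<close>

lemma row_sum:
  assumes "i \<in> {1..n}" "J \<subseteq> {1..n}"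
  shows "(\<Sum>j\<in>J. A i j * g j) = of_bool (f i \<in> J) * g (f i)
    + of_bool (i = p) * (of_bool (c \<in> J) * g c - of_bool (q \<in> J) * g q)"
proof -
  have fin: "finite J" using assms by (auto intro: finite_subset)
  have "(\<Sum>j\<in>J. A i j * g j) = (\<Sum>j\<in>J. (if j = f i then g j else 0)
      + of_bool (i = p) * ((if j = c then g j else 0) - (if j = q then g j else 0)))"
    by (rule sum.cong) (use assms in \<open>auto simp: entry\<close>)
  also have "\<dots> = (\<Sum>j\<in>J. if j = f i then g j else 0)
      + of_bool (i = p) * ((\<Sum>j\<in>J. if j = c then g j else 0) - (\<Sum>j\<in>J. if j = q then g j else 0))"
    by (simp only: sum.distrib sum_distrib_left[symmetric] sum_subtractf)
  also have "\<dots> = of_bool (f i \<in> J) * g (f i)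
    + of_bool (i = p) * (of_bool (c \<in> J) * g c - of_bool (q \<in> J) * g q)"
    using fin by simp
  finally show ?thesis .
qed

lemma block_sum:
  assumes "I \<subseteq> {1..n}" "J \<subseteq> {1..n}"
  shows "(\<Sum>i\<in>I. \<Sum>j\<in>J. A i j) = int (card {i \<in> I. f i \<in> J})
    + of_bool (p \<in> I) * (of_bool (c \<in> J) - of_bool (q \<in> J))"
proof -
  have fin: "finite I" using assms by (auto intro: finite_subset)
  have "(\<Sum>i\<in>I. \<Sum>j\<in>J. A i j)
      = (\<Sum>i\<in>I. of_bool (f i \<in> J) + (if i = p then of_bool (c \<in> J) - of_bool (q \<in> J) else 0))"
    by (rule sum.cong) (use row_sum[OF _ assms(2), of _ "\<lambda>_. 1"] assms(1) in \<open>auto simp: subset_iff\<close>)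
  also have "\<dots> = (\<Sum>i\<in>I. of_bool (f i \<in> J))
      + (\<Sum>i\<in>I. if i = p then of_bool (c \<in> J) - of_bool (q \<in> J) else 0)"
    by (simp only: sum.distrib)
  also have "(\<Sum>i\<in>I. of_bool (f i \<in> J)) = int (card {i \<in> I. f i \<in> J})"
    using fin by (simp add: Int_def)
  also have "(\<Sum>i\<in>I. if i = p then of_bool (c \<in> J) - of_bool (q \<in> J) else 0)
      = of_bool (p \<in> I) * (of_bool (c \<in> J) - of_bool (q \<in> J) :: int)"
    using fin by simp
  finally show ?thesis .
qed

lemma cc_eq: "cc n A = int (card {i \<in> {p<..n}. q < f i \<and> f i < c})"
  unfolding cc_def clos_row_eq open_col_eq clos_col_eq
  using c_le by (subst block_sum) auto

lemma sw_eq: "i \<in> {1..n} \<Longrightarrow> x \<in> {1..n} \<Longrightarrow> (\<Sum>k\<in>{i<..n}. \<Sum>l\<in>{1..<x}. A k l) = sw i x"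
proof -
  assume ix: "i \<in> {1..n}" "x \<in> {1..n}"
  have "{k \<in> {i<..n}. f k \<in> {1..<x}} = {k \<in> {i<..n}. f k < x}"
    using f_range ix by fastforce
  moreover have "(\<Sum>k\<in>{i<..n}. \<Sum>l\<in>{1..<x}. A k l) = int (card {k \<in> {i<..n}. f k \<in> {1..<x}})
      + of_bool (p \<in> {i<..n}) * (of_bool (c \<in> {1..<x}) - of_bool (q \<in> {1..<x}))"
    using ix by (intro block_sum) auto
  ultimately show ?thesis using rows cols by (simp add: sw_def)
qed

text \<open>Besides \<open>sw p (f p)\<close>, row \<open>p\<close> contributes
  \<open>sw p c - sw p q\<close>: the entries below it in the columns from \<open>q\<close> up to
  but excluding \<open>c\<close>, that is, the 1 of row \<open>m\<close> and the closing
  cell.\<close>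

lemma inv_eq_sw: "inv n A = (\<Sum>i\<in>{1..n}. sw i (f i)) + cc n A + 1"
proof -
  have "inv n A = (\<Sum>i\<in>{1..n}. \<Sum>j\<in>{1..n}. A i j * sw i j)"
    unfolding inv_def by (intro sum.cong refl) (simp add: sum_distrib_left[symmetric] sw_eq[symmetric])
  also have "\<dots> = (\<Sum>i\<in>{1..n}. sw i (f i) + (if i = p then sw i c - sw i q else 0))"
    by (rule sum.cong) (use row_sum f_range c_le cols in auto)
  also have "\<dots> = (\<Sum>i\<in>{1..n}. sw i (f i)) + (sw p c - sw p q)"
    using rows by (simp add: sum.distrib)
  also have "sw p c - sw p q = cc n A + 1"
  proof -
    have "{k \<in> {p<..n}. f k < c} = {k \<in> {p<..n}. f k < q} \<union> insert m {k \<in> {p<..n}. q < f k \<and> f k < c}"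
    proof -
      have "f k < c \<longleftrightarrow> f k < q \<or> k = m \<or> q < f k \<and> f k < c" if "k \<in> {p<..n}" for k
        using that f_eq_q[of k] cols rows by force
      then show ?thesis using rows by auto
    qed
    moreover have "card ({k \<in> {p<..n}. f k < q} \<union> insert m {k \<in> {p<..n}. q < f k \<and> f k < c})
      = card {k \<in> {p<..n}. f k < q} + Suc (card {k \<in> {p<..n}. q < f k \<and> f k < c})"
      using f_m by (subst card_Un_disjoint) auto
    ultimately show ?thesis by (simp add: sw_def cc_eq)
  qed
  finally show ?thesis by simp
qed

lemma charge_eq: "charge n A = int (card {i \<in> {u<..<p}. q < f i})"
proof -
  have "{i \<in> {u<..<p}. f i \<in> {q<..n}} = {i \<in> {u<..<p}. q < f i}"
    using f_range rows by fastforce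
  moreover have "charge n A = int (card {i \<in> {u<..<p}. f i \<in> {q<..n}})
      + of_bool (p \<in> {u<..<p}) * (of_bool (c \<in> {q<..n}) - of_bool (q \<in> {q<..n}))"
    unfolding charge_def open_row_eq open_col_eq clos_row_eq using rows by (intro block_sum) auto
  ultimately show ?thesis by simp
qed

lemma Epar_eq:
  assumes "\<not> negative A"
  shows "Epar n A = int (card {i \<in> {u<..<p}. q < f i})"
proof (cases "neutral A")
  case True
  then have "{u<..<p} = {}" by (auto simp: neutral_iff)
  then show ?thesis using True by (simp add: Epar_def positive_def)
next
  case False
  then have "positive A" using assms sign_cases by (auto simp: neutral_iff negative_iff positive_iff)
  then show ?thesis by (simp add: Epar_def charge_eq)
qed

lemma inv_eq_dperm:
  "\<not> negative A \<Longrightarrow> inv n A = (\<Sum>i\<in>{1..n}. int (inv_dperm i)) + Epar n A + cc n A + 1"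
  unfolding inv_eq_sw sum_sw using Epar_eq by simp

lemma least_one: "i \<in> {1..n} \<Longrightarrow> (LEAST j. A i j = 1) = f i"
  by (rule Least_equality) (use cols in \<open>auto simp: one_iff\<close>)

lemma git_a_eq: "i \<in> {1..n} \<Longrightarrow> git_a n A i = sw (n + 1 - i) (f (n + 1 - i))"
proof -
  assume "i \<in> {1..n}"
  then have r: "n + 1 - i \<in> {1..n}" by auto
  show ?thesis unfolding git_a_def Let_def least_one[OF r] using sw_eq[OF r f_range[OF r]] .
qed

lemma rstat_eq: "rstat A = f 1 - 1"
proof -
  have 1: "1 \<in> {1..n}" "1 \<noteq> p" using rows by auto
  have "(LEAST j. A 1 j \<noteq> 0) = f 1"
    by (rule Least_equality) (use 1 f_range[OF 1(1)] in \<open>auto simp: entry split: if_splits\<close>)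
  then show ?thesis by (simp add: rstat_def)
qed

lemma rstat_eq_sw: "int (rstat A) = sw 1 (f 1)"
proof -
  have 1: "1 \<in> {1..n}" "1 \<le> u" using rows by auto
  have "{k \<in> {1..1}. f k < f 1} = {}" by auto
  then show ?thesis using sw_high[OF 1] f_range[OF 1(1)] rstat_eq by simp
qed

lemma dperm_Suc_u: "dperm (Suc u) = f (nxt lefts u)"
  using rows u_lefts by (simp add: dperm_def)

lemma nxt_lefts_u: "nxt lefts u \<in> lefts" "u < nxt lefts u" "nxt lefts u \<le> p" "f (nxt lefts u) < q"
proof -
  show nx: "nxt lefts u \<in> lefts" "u < nxt lefts u" "nxt lefts u \<le> p"
    using nxt_props[OF finite_lefts p_lefts rows(2)] by auto
  show "f (nxt lefts u) < q" using lefts_iff nx by auto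
qed

text \<open>The search for the leading 1 could run past the closing row, but row \<open>p\<close>
  has a 1 in the left side, so it stops within \<open>lefts\<close>.\<close>

lemma lead_row_eq: "lead_row A = nxt lefts u"
  unfolding lead_row_def open_row_eq open_col_eq
proof (rule Least_equality)
  show "u < nxt lefts u \<and> (\<exists>j<q. A (nxt lefts u) j = 1)"
    using nxt_lefts_u rows by (auto simp: one_iff intro!: exI[of _ "f (nxt lefts u)"])
  fix y assume y: "u < y \<and> (\<exists>j<q. A y j = 1)"
  then have "f y < q" using cols by (auto simp: one_iff)
  then show "nxt lefts u \<le> y"
    using y nxt_props(3)[OF finite_lefts, of y u] lefts_iff[of y] nxt_lefts_u by (cases "y \<le> p") auto
qed

text \<open>\<open>V\<close> raises the leading 1 to row \<open>u\<close> and lowering puts it in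
  row \<open>Suc u\<close>, so the leading column can be read off the discharged
  permutation.\<close>

lemma lead_col_eq: "lead_col A = dperm (Suc u)"
  unfolding lead_col_def open_col_eq lead_row_eq dperm_Suc_u
  by (rule the_equality) (use nxt_lefts_u rows cols in \<open>auto simp: one_iff\<close>)

lemma dperm_Suc_u_less: "dperm (Suc u) < q"
  using nxt_lefts_u by (simp add: dperm_Suc_u)

lemma ell_eq: "ell n A = int (card {i \<in> {u<..n}. dperm (Suc u) < f i \<and> f i < q})"
  unfolding ell_def open_row_eq open_col_eq lead_col_eq
  using c_le cols by (subst block_sum) auto

text \<open>Each column left of \<open>q\<close> is a value of \<open>f\<close> exactly once, so the
  leading cell is counted by the columns that the first \<open>u\<close> rows leave free. Everything
  in this form is shared by a matrix and its neutralization.\<close>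

lemma ell_eq_free_columns: "ell n A = int (card ({dperm (Suc u)<..<q} - f ` {1..u}))"
proof -
  let ?X = "{i \<in> {u<..n}. dperm (Suc u) < f i \<and> f i < q}"
  have inj: "inj_on f ?X"
  proof (rule inj_onI)
    fix x y assume xy: "x \<in> ?X" "y \<in> ?X" "f x = f y"
    then have "x \<noteq> m" "y \<noteq> m" using f_m by blast+
    then show "x = y" using f_eq[of x y] xy rows by simp
  qed
  have "f ` ?X = {dperm (Suc u)<..<q} - f ` {1..u}"
  proof
    have "f x \<noteq> f y" if "x \<in> ?X" "y \<in> {1..u}" for x y
    proof -
      have "x \<noteq> m" using that f_m by blast
      then show ?thesis using that f_eq[of x y] rows by auto
    qed
    then have "f x \<notin> f ` {1..u}" if "x \<in> ?X" for x using that by (metis (no_types, lifting) imageE)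
    then show "f ` ?X \<subseteq> {dperm (Suc u)<..<q} - f ` {1..u}" by auto
    show "{dperm (Suc u)<..<q} - f ` {1..u} \<subseteq> f ` ?X"
    proof
      fix j assume j: "j \<in> {dperm (Suc u)<..<q} - f ` {1..u}"
      then have "j \<in> {1..n}" "j \<noteq> c" using cols c_le by auto
      then obtain i where i: "i \<in> {1..n}" "f i = j" using f_surj[of j] by blast
      then show "j \<in> f ` ?X" using j by (intro image_eqI[of _ _ i]) auto
    qed
  qed
  then show ?thesis using card_image[OF inj] by (simp add: ell_eq)
qed

lemma dperm_below: "dperm ` {p<..n} = insert c (f ` {p<..n} - {q})"
proof -
  have "dperm ` {p<..n} = shift ` f ` {p<..n}" using rows by (auto simp: dperm_def image_iff)
  then show ?thesis by (simp only: shift_image)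
qed

text \<open>The columns met below row \<open>p\<close> change only at the endpoints \<open>q\<close>
  and \<open>c\<close>, so those strictly between them are the same before and after.\<close>

lemma cc_dperm: "cc n A = int (card {x \<in> dperm ` {p<..n}. q < x \<and> x < c})"
proof -
  have "{x \<in> dperm ` {p<..n}. q < x \<and> x < c} = f ` {i \<in> {p<..n}. q < f i \<and> f i < c}"
    unfolding dperm_below by auto
  moreover have "inj_on f {i \<in> {p<..n}. q < f i \<and> f i < c}"
    using f_inj_below by (rule inj_on_subset) auto
  ultimately show ?thesis by (simp add: cc_eq card_image)
qed

lemma act_dperm: "act = insert q {x \<in> dperm ` {p<..n}. q < x \<and> x \<le> c}"
proof -
  have "q \<in> f ` {p<..n}" using f_m rows by (intro image_eqI[of _ _ m]) auto
  then show ?thesis unfolding dperm_below act_def using cols by auto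
qed

text \<open>Together with \<open>act_dperm\<close> this recovers \<open>f\<close> below the closing
  row from \<open>dperm\<close>, \<open>q\<close> and \<open>c\<close> alone.\<close>

lemma f_of_dperm:
  assumes "i \<in> {p<..n}"
  shows "f i = (if q < dperm i \<and> dperm i \<le> c then prv act (dperm i) else dperm i)"
proof -
  have d: "dperm i = shift (f i)" using assms rows by (auto simp: dperm_def)
  show ?thesis
  proof (cases "q \<le> f i \<and> f i < c")
    case True
    then show ?thesis using shift_f[OF assms] unfolding d by auto
  next
    case False
    then have "f i < q \<or> c < f i" using f_neq_c[of i] assms rows by force
    then show ?thesis unfolding d by (auto simp: shift_id)
  qed
qed

end

section \<open>Reconstruction of a neutral matrix from its discharged permutation\<close>

lemma delta_eq_dperm:
  assumes "one_neg n A f u p m q c" "one_neg n A' f' u' p' m' q' c'" "delta n A = delta n A'"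
    and i: "i \<in> {1..n}"
  shows "one_neg.dperm n f u p q c i = one_neg.dperm n f' u' p' q' c' i"
proof -
  interpret X: one_neg n A f u p m q c by fact
  interpret Y: one_neg n A' f' u' p' m' q' c' by fact
  have "delta n A i (X.dperm i) = 1" using X.delta_eq[of i "X.dperm i"] i X.dperm_range[OF i] by simp
  then show ?thesis using Y.delta_eq[of i "X.dperm i"] i X.dperm_range[OF i] assms(3)
    by (auto split: if_splits)
qed

text \<open>Without enclosed rows the leading row is the closing row.\<close>

lemma neutral_dperm:
  assumes "one_neg n A f u (Suc u) m q c"
  shows "one_neg.dperm n f u (Suc u) q c (Suc u) = f (Suc u)"
proof -
  interpret one_neg n A f u "Suc u" m q c by fact
  have "nxt lefts u = Suc u" using nxt_lefts_u(2,3) by simp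
  then show ?thesis by (simp only: dperm_Suc_u)
qed

text \<open>\<open>q\<close> is the value at row \<open>u\<close>, where nothing moves. Both
  \<open>c\<close> and \<open>c'\<close> are columns with the same rank beyond \<open>q\<close>, and
  ranks grow strictly; then \<open>f_of_dperm\<close> returns \<open>f\<close>.\<close>

lemma neutral_unique:
  assumes X: "one_neg n A f u (Suc u) m q c" and Y: "one_neg n A' f' u (Suc u) m' q' c'"
    and delta: "delta n A = delta n A'" and cc: "cc n A = cc n A'"
  shows "A = A'"
proof -
  interpret X: one_neg n A f u "Suc u" m q c by fact
  interpret Y: one_neg n A' f' u "Suc u" m' q' c' by fact
  have d: "X.dperm i = Y.dperm i" if "i \<in> {1..n}" for i
    using delta_eq_dperm[OF X Y delta that] .
  have un: "u \<in> {1..n}" "Suc u \<in> {1..n}" using X.rows by auto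
  have high: "f i = f' i" if "i \<in> {1..u}" for i
    using d[of i] that X.rows by (simp add: X.dperm_def Y.dperm_def)
  have q: "q = q'" using high[of u] X.f_u Y.f_u X.rows by simp
  have D: "X.dperm ` {Suc u<..n} = Y.dperm ` {Suc u<..n}"
    by (rule image_cong) (use d in auto)
  let ?D = "X.dperm ` {Suc u<..n}"
  have mem: "c \<in> ?D" "c' \<in> ?D" using X.dperm_below Y.dperm_below D by auto
  have card: "card {x \<in> ?D. q < x \<and> x < c} = card {x \<in> ?D. q < x \<and> x < c'}"
    using cc X.cc_dperm Y.cc_dperm D q by simp
  have lt: "card {x \<in> ?D. q < x \<and> x < y} < card {x \<in> ?D. q < x \<and> x < z}" if "y \<in> ?D" "q < y" "y < z" for y z
    using that by (intro psubset_card_mono) auto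
  have c: "c = c'"
    using lt[OF mem(1), of c'] lt[OF mem(2), of c] X.cols(2) Y.cols(2) q card
    by (cases c c' rule: linorder_cases) simp_all
  have act: "X.act = Y.act"
    by (simp only: X.act_dperm Y.act_dperm D) (simp only: q c)
  have "f i = f' i" if i: "i \<in> {1..n}" for i
  proof -
    consider "i \<in> {1..u}" | "i = Suc u" | "i \<in> {Suc u<..n}" using i by force
    then show ?thesis
    proof cases
      case 2
      then show ?thesis using d[OF un(2)] neutral_dperm[OF X] neutral_dperm[OF Y] by simp
    next
      case 3
      then show ?thesis using X.f_of_dperm[OF 3] Y.f_of_dperm[OF 3] d[OF i] act q c by simp
    qed (rule high)
  qed
  then have "A i j = A' i j" for i j unfolding X.entry Y.entry q c by simp
  then show ?thesis by (intro ext)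
qed

text \<open>This makes room for a closing column of rank \<open>cc n A + Epar n A\<close>. The
  charged 1s, lowered by one row, give \<open>Epar n A\<close> columns beyond \<open>q\<close>; the
  rows below \<open>p\<close> give the \<open>cc n A\<close> columns of the closing cell and also
  \<open>c\<close>, whence strictness.\<close>

lemma (in one_neg) card_active:
  assumes "\<not> negative A"
  shows "nat (cc n A + Epar n A) < card {x \<in> dperm ` {Suc u<..n}. q < x}"
proof -
  let ?R1 = "Suc ` {i \<in> {u<..<p}. q < f i}" and ?R2 = "{i \<in> {p<..n}. q < dperm i \<and> dperm i \<le> c}"
  have inj: "inj_on dperm S" if "S \<subseteq> {1..n}" for S
    using bij_betw_imp_inj_on[OF dperm_bij] that by (rule inj_on_subset)
  have R1: "?R1 \<subseteq> {Suc u<..p}" "\<And>i. i \<in> ?R1 \<Longrightarrow> q < dperm i"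
    by (auto simp: dperm_def lefts_def)
  have R2: "?R2 \<subseteq> {p<..n}" by auto
  have "dperm ` (?R1 \<union> ?R2) \<subseteq> {x \<in> dperm ` {Suc u<..n}. q < x}"
    using R1 R2 rows by fastforce
  then have "card (dperm ` (?R1 \<union> ?R2)) \<le> card {x \<in> dperm ` {Suc u<..n}. q < x}"
    by (intro card_mono) auto
  moreover have "card (dperm ` (?R1 \<union> ?R2)) = card ?R1 + card ?R2"
  proof -
    have "?R1 \<union> ?R2 \<subseteq> {1..n}" using R1(1) R2 rows by fastforce
    then have "card (dperm ` (?R1 \<union> ?R2)) = card (?R1 \<union> ?R2)" by (intro card_image inj)
    also have "\<dots> = card ?R1 + card ?R2" using R1(1) by (intro card_Un_disjoint) fastforce+
    finally show ?thesis .
  qed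
  moreover have "int (card ?R1) = Epar n A" by (simp add: Epar_eq[OF assms] card_image)
  moreover have "int (card ?R2) = cc n A + 1"
  proof -
    have "card ?R2 = card (dperm ` ?R2)" by (rule card_image[symmetric], rule inj) (use rows in auto)
    also have "dperm ` ?R2 = {x \<in> dperm ` {p<..n}. q < x \<and> x \<le> c}" by blast
    also have "\<dots> = insert c {x \<in> dperm ` {p<..n}. q < x \<and> x < c}"
      unfolding dperm_below using cols by auto
    also have "card \<dots> = Suc (card {x \<in> dperm ` {p<..n}. q < x \<and> x < c})" by simp
    finally show ?thesis by (simp add: cc_dperm)
  qed
  ultimately show ?thesis using cc_eq Epar_eq[OF assms] by linarith
qed

text \<open>\<open>H\<close> is run backwards: \<open>y\<close>, the column of rank
  \<open>r\<close>, becomes the closing column, \<open>T\<close> the active set, and each member of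
  \<open>T\<close> beyond \<open>P u\<close> is pulled back to its predecessor. Hypothesis
  \<open>l\<close> puts the leftmost 1 of the closing row in the left side.\<close>

lemma neutral_exists:
  fixes P :: "nat \<Rightarrow> nat"
  assumes P: "bij_betw P {1..n} {1..n}" and u: "1 \<le> u" "Suc u \<le> n" and l: "P (Suc u) < P u"
    and r: "r < card {x \<in> P ` {Suc u<..n}. P u < x}"
  obtains N f m c where "one_neg n N f u (Suc u) m (P u) c"
    "\<And>i. i \<in> {1..n} \<Longrightarrow> one_neg.dperm n f u (Suc u) (P u) c i = P i" "cc n N = int r"
proof -
  let ?q = "P u" and ?D = "P ` {Suc u<..n}"
  obtain y where y: "y \<in> ?D" "?q < y" and card: "card {x \<in> {x \<in> ?D. ?q < x}. x < y} = r"
    using ex_card_less[OF _ r] by auto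
  define T where "T = insert ?q {x \<in> ?D. ?q < x \<and> x \<le> y}"
  define f where "f i = (if i \<le> Suc u then P i else if ?q < P i \<and> P i \<le> y then prv T (P i) else P i)" for i
  have fin: "finite T" and qT: "?q \<in> T" and yT: "y \<in> T" using y by (auto simp: T_def)
  have T_le: "x \<in> T \<Longrightarrow> x \<le> y" and T_ge: "x \<in> T \<Longrightarrow> ?q \<le> x" and T_D: "x \<in> T \<Longrightarrow> x \<noteq> ?q \<Longrightarrow> x \<in> ?D" for x
    using y by (auto simp: T_def)
  have P_inj: "i = k" if "i \<in> {1..n}" "k \<in> {1..n}" "P i = P k" for i k
    using inj_onD[OF bij_betw_imp_inj_on[OF P]] that by blast
  have pre: "\<exists>i\<in>{Suc u<..n}. P i = nxt T x \<and> f i = x" if x: "x \<in> T" "x < y" for x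
  proof -
    note nx = nxt_props[OF fin yT x(2)]
    have "nxt T x \<noteq> ?q" using nx T_ge[OF x(1)] by auto
    then obtain i where i: "i \<in> {Suc u<..n}" "P i = nxt T x" using T_D[OF nx(1)] by auto
    have "?q < nxt T x" using nx T_ge[OF x(1)] by auto
    then have "f i = prv T (nxt T x)" using i nx by (simp add: f_def)
    also have "\<dots> = x" by (rule prv_nxt[OF fin x(1) yT x(2)])
    finally show ?thesis using i by auto
  qed
  \<comment> \<open>The row pulled back to column \<open>P u\<close> carries the 1 of the opening
    column below the -1.\<close>
  obtain m where m: "m \<in> {Suc u<..n}" "P m = nxt T ?q" "f m = ?q" using pre[OF qT y(2)] by auto
  have nq: "nxt T ?q \<in> T" "?q < nxt T ?q" "nxt T ?q \<le> y" using nxt_props[OF fin yT y(2)] by auto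
  define N where "N = (\<lambda>i j. if i \<in> {1..n} \<and> j \<in> {1..n}
      then of_bool (j = f i) + of_bool (i = Suc u) * (of_bool (j = y) - of_bool (j = ?q)) else 0 :: int)"
  have P_range: "P i \<in> {1..n}" if "i \<in> {1..n}" for i using bij_betwE[OF P] that by blast
  have y_range: "y \<in> {1..n}" using y P_range u by auto
  have low: "?q < P i \<Longrightarrow> P i \<le> y \<Longrightarrow> prv T (P i) \<in> T \<and> prv T (P i) < P i \<and> nxt T (prv T (P i)) = P i"
    if "i \<in> {Suc u<..n}" for i
  proof -
    assume *: "?q < P i" "P i \<le> y"
    have "P i \<in> T" using * that by (auto simp: T_def)
    then show ?thesis using prv_props[OF fin qT *(1)] nxt_prv[OF fin _ qT *(1)] by auto
  qed
  have T_range: "x \<in> {1..n}" if "x \<in> T" for x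
    using T_le[OF that] T_ge[OF that] y_range P_range[of u] u by auto
  have f_range: "f i \<in> {1..n}" if "i \<in> {1..n}" for i
    using that P_range[OF that] low[of i] T_range by (auto simp: f_def)
  have surj: "j \<in> (f(m := y)) ` {1..n}" if j: "j \<in> {1..n}" for j
  proof -
    have "j \<in> P ` {1..n}" using j P by (simp add: bij_betw_def)
    then obtain i where i: "i \<in> {1..n}" "P i = j" by blast
    have m_in: "m \<in> {1..n}" using m by auto
    consider "j = y" | "j < y" "j \<in> T" "j \<noteq> ?q" | "j = ?q" | "j \<notin> T" using T_le[of j] by force
    then show ?thesis
    proof cases
      case 1 then show ?thesis using m_in by (intro image_eqI[of _ _ m]) auto
    next
      case 2
      then obtain i' where i': "i' \<in> {Suc u<..n}" "f i' = j" using pre by blast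
      then show ?thesis using 2 m by (intro image_eqI[of _ _ i']) auto
    next
      case 3
      then show ?thesis using u m by (intro image_eqI[of _ _ u]) (auto simp: f_def)
    next
      case 4
      then have "i \<noteq> m" using i m nq by auto
      moreover have "f i = j"
      proof (cases "i \<le> Suc u")
        case False
        then have "\<not> (?q < P i \<and> P i \<le> y)" using 4 i by (auto simp: T_def)
        then show ?thesis using i False by (auto simp: f_def)
      qed (use i in \<open>simp add: f_def\<close>)
      ultimately show ?thesis using i by (intro image_eqI[of _ _ i]) auto
    qed
  qed
  have bij: "bij_betw (f(m := y)) {1..n} {1..n}"
  proof -
    have "(f(m := y)) i \<in> {1..n}" if "i \<in> {1..n}" for i using f_range[OF that] y_range by simp
    then have "(f(m := y)) ` {1..n} = {1..n}" using surj by blast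
    then show ?thesis by (simp add: bij_betw_def eq_card_imp_inj_on)
  qed
  have N: "one_neg n N f u (Suc u) m ?q y"
    by unfold_locales (use bij u m y l in \<open>auto simp: N_def f_def\<close>)
  interpret one_neg n N f u "Suc u" m ?q y by (rule N)
  \<comment> \<open>With the active set of the new matrix identified, its \<open>shift\<close>
    undoes the pullback used to define \<open>f\<close>.\<close>
  have "act = T"
  proof
    show "T \<subseteq> act"
    proof
      fix x assume x: "x \<in> T"
      show "x \<in> act"
      proof (cases "x = y")
        case False
        then obtain i where "i \<in> {Suc u<..n}" "f i = x" using pre[OF x] T_le[OF x] by auto
        then show ?thesis using T_ge[OF x] T_le[OF x] by (auto simp: act_def)
      qed (use c_act in simp)
    qed
    show "act \<subseteq> T"
    proof
      fix x assume x: "x \<in> act"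
      show "x \<in> T"
      proof (cases "x = y")
        case False
        then obtain i where i: "i \<in> {Suc u<..n}" "f i = x" using act_f[OF x] by auto
        have "P i \<noteq> ?q" using P_inj[of i u] i u by auto
        then have "?q < P i \<and> P i \<le> y" using i act_ge[OF x] act_le[OF x] by (auto simp: f_def split: if_splits)
        then show ?thesis using low[OF i(1)] i by (auto simp: f_def)
      qed (use yT in simp)
    qed
  qed
  have dperm: "dperm i = P i" if i: "i \<in> {1..n}" for i
  proof -
    consider "i \<le> u" | "i = Suc u" | "i \<in> {Suc u<..n}" using i by force
    then show ?thesis
    proof cases
      case 1 then show ?thesis by (simp add: dperm_def f_def)
    next
      case 2 then show ?thesis using neutral_dperm[OF N] by (simp add: f_def)
    next
      case 3
      have "shift (f i) = P i"
      proof (cases "?q < P i \<and> P i \<le> y")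
        case True
        then have "f i = prv T (P i)" using 3 by (simp add: f_def)
        then show ?thesis using low[OF 3] True T_ge[of "prv T (P i)"] \<open>act = T\<close> by (simp add: shift_def)
      next
        case False
        have "P i \<noteq> ?q" using P_inj[of i u] 3 u by auto
        then show ?thesis using False 3 shift_id[of "P i"] by (auto simp: f_def)
      qed
      then show ?thesis using 3 by (simp add: dperm_def)
    qed
  qed
  have "dperm ` {Suc u<..n} = ?D" by (rule image_cong) (use dperm in auto)
  moreover have "{x \<in> ?D. ?q < x \<and> x < y} = {x \<in> {x \<in> ?D. ?q < x}. x < y}" by auto
  ultimately have "cc n N = int r" using cc_dperm card by simp
  with N dperm show thesis by (rule that)
qed

section \<open>Lattice paths\<close>

lemma walk_append: "walk v (xs @ ys) = walk (walk v xs) ys"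
  by (induction v xs rule: walk.induct) auto

lemma walk_replicate_E: "walk (x, y) (replicate t StE) = (x + int t, y)"
  by (induction t arbitrary: x) auto

lemma walk_replicate_F: "walk (x, y) (replicate t StF) = (x + int t, y)"
  by (induction t arbitrary: x) auto

text \<open>The words of \<open>Phi\<close> with natural exponents. The final runs of F-steps enter
  as an arbitrary \<open>tail\<close>: they come after every junction and every N- and
  S-step.\<close>

locale config_shape =
  fixes n k :: nat and \<alpha> tail :: "nat \<Rightarrow> nat" and b \<beta> :: nat and \<Omega> :: config
  assumes k: "2 \<le> k" "k \<le> n"
    and \<Omega>: "\<Omega> i = replicate (\<alpha> i) StE
      @ (if i = k - 1 then replicate \<beta> StF @ [StN] else if i = k then [StS] @ replicate b StE else [])
      @ replicate (tail i) StF"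
begin

lemma nth_pred: "t < length (\<Omega> (k - 1)) \<Longrightarrow>
    \<Omega> (k - 1) ! t = (if t < \<alpha> (k - 1) then StE else if t = \<alpha> (k - 1) + \<beta> then StN else StF)"
proof (cases "t < \<alpha> (k - 1)")
  case False
  assume t: "t < length (\<Omega> (k - 1))"
  from False obtain d where d: "t = \<alpha> (k - 1) + d" by (metis le_add_diff_inverse not_less)
  then show ?thesis using t by (auto simp: \<Omega> nth_append nth_Cons')
qed (simp add: \<Omega> nth_append)

lemma nth_k: "t < length (\<Omega> k) \<Longrightarrow>
    \<Omega> k ! t = (if t < \<alpha> k then StE else if t = \<alpha> k then StS else if t \<le> \<alpha> k + b then StE else StF)"
proof (cases "t < \<alpha> k")
  case False
  assume t: "t < length (\<Omega> k)"
  from False obtain d where d: "t = \<alpha> k + d" by (metis le_add_diff_inverse not_less)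
  then show ?thesis using t k by (auto simp: \<Omega> nth_append nth_Cons')
qed (simp add: \<Omega> nth_append)

lemma nth_other: "t < length (\<Omega> i) \<Longrightarrow> i \<noteq> k - 1 \<Longrightarrow> i \<noteq> k \<Longrightarrow> \<Omega> i ! t = (if t < \<alpha> i then StE else StF)"
  by (simp add: \<Omega> nth_append)

lemma nth_E:
  assumes t: "t < length (\<Omega> i)"
  shows "\<Omega> i ! t = StE \<longleftrightarrow> t < \<alpha> i \<or> i = k \<and> \<alpha> k < t \<and> t \<le> \<alpha> k + b"
proof (cases "i = k")
  case True
  show ?thesis using nth_k[of t] t unfolding True by simp
next
  case False
  show ?thesis
  proof (cases "i = k - 1")
    case True
    show ?thesis using nth_pred[of t] t \<open>i \<noteq> k\<close> unfolding True by simp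
  next
    case False
    then show ?thesis using nth_other[OF t] \<open>i \<noteq> k\<close> by simp
  qed
qed

lemma nth_N: "t < length (\<Omega> i) \<and> \<Omega> i ! t = StN \<longleftrightarrow> i = k - 1 \<and> t = \<alpha> (k - 1) + \<beta>"
proof (cases "i = k - 1")
  case True
  have "\<alpha> (k - 1) + \<beta> < length (\<Omega> (k - 1))" by (simp add: \<Omega>)
  moreover have "\<Omega> (k - 1) ! t = StN \<longleftrightarrow> t = \<alpha> (k - 1) + \<beta>" if "t < length (\<Omega> (k - 1))"
    by (simp only: nth_pred[OF that]) simp
  ultimately show ?thesis unfolding True by blast
next
  case False
  have "\<Omega> i ! t \<noteq> StN" if t: "t < length (\<Omega> i)"
  proof (cases "i = k")
    case True
    show ?thesis using nth_k[of t] t unfolding True by simp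
  qed (use False nth_other[OF t] in simp)
  then show ?thesis using False by blast
qed

lemma nth_S: "t < length (\<Omega> i) \<and> \<Omega> i ! t = StS \<longleftrightarrow> i = k \<and> t = \<alpha> k"
proof (cases "i = k")
  case True
  have "\<alpha> k < length (\<Omega> k)" using k by (simp add: \<Omega>)
  moreover have "\<Omega> k ! t = StS \<longleftrightarrow> t = \<alpha> k" if "t < length (\<Omega> k)"
    by (simp only: nth_k[OF that]) simp
  ultimately show ?thesis unfolding True by blast
next
  case False
  have "\<Omega> i ! t \<noteq> StS" if t: "t < length (\<Omega> i)"
  proof (cases "i = k - 1")
    case True
    show ?thesis using nth_pred[of t] t unfolding True by simp
  qed (use False nth_other[OF t] in simp)
  then show ?thesis using False by blast
qed

lemma occ_N: "s \<in> occ n \<Omega> \<and> st_kind \<Omega> s = StN \<longleftrightarrow> s = (k - 1, \<alpha> (k - 1) + \<beta>)"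
  using nth_N[of "snd s" "fst s"] k by (cases s) (auto simp: occ_def st_kind_def)

lemma occ_S: "s \<in> occ n \<Omega> \<and> st_kind \<Omega> s = StS \<longleftrightarrow> s = (k, \<alpha> k)"
  using nth_S[of "snd s" "fst s"] k by (cases s) (auto simp: occ_def st_kind_def)

lemma walk_E: "t \<le> \<alpha> i \<Longrightarrow> walk (0, int i) (take t (\<Omega> i)) = (int t, int i)"
  by (simp add: \<Omega> walk_replicate_E)

lemma walk_after_S:
  assumes "\<alpha> k < t" "t \<le> \<alpha> k + b + 1"
  shows "walk (0, int k) (take t (\<Omega> k)) = (int t - 1, int k - 1)"
proof -
  obtain d where d: "t = \<alpha> k + Suc d" using assms(1) less_iff_Suc_add by auto
  then have "take t (\<Omega> k) = replicate (\<alpha> k) StE @ [StS] @ replicate d StE"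
    using assms k by (simp add: \<Omega>)
  then show ?thesis using d by (simp add: walk_append walk_replicate_E)
qed

lemma st_end_N: "st_end \<Omega> (k - 1, \<alpha> (k - 1) + \<beta>) = (int (\<alpha> (k - 1)) + int \<beta> + 1, int k)"
  using k by (simp add: st_end_def \<Omega> walk_append walk_replicate_E walk_replicate_F)

lemma st_start_S: "st_start \<Omega> (k, \<alpha> k) = (int (\<alpha> k), int k)"
  using walk_E[of "\<alpha> k" k] by (simp add: st_start_def)

lemma junction_pred: "junction \<Omega> (k - 1) = (int (\<alpha> (k - 1)), int k - 1)"
proof -
  have "takeWhile (\<lambda>s. s \<in> {StS, StE}) (\<Omega> (k - 1)) = replicate (\<alpha> (k - 1)) StE"
    by (cases \<beta>) (auto simp: \<Omega> takeWhile_append)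
  then show ?thesis using k by (simp add: junction_def walk_replicate_E)
qed

lemma junction_k: "junction \<Omega> k = (int (\<alpha> k) + int b, int k - 1)"
proof -
  have "takeWhile (\<lambda>s. s \<in> {StS, StE}) (\<Omega> k) = replicate (\<alpha> k) StE @ [StS] @ replicate b StE"
    using k by (cases "tail k") (auto simp: \<Omega> takeWhile_append)
  then show ?thesis using k by (simp add: junction_def walk_append walk_replicate_E)
qed

text \<open>E-steps after the S-step lie at height \<open>k - 1 < n\<close>, all others at the
  starting height of their path; this covers the case \<open>k = n\<close> too.\<close>

lemma top_E_steps:
  "{s \<in> occ n \<Omega>. st_kind \<Omega> s = StE \<and> snd (st_start \<Omega> s) = int n \<and> snd (st_end \<Omega> s) = int n}
    = {n} \<times> {..<\<alpha> n}"
proof -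
  have "s \<in> occ n \<Omega> \<and> st_kind \<Omega> s = StE \<and> snd (st_start \<Omega> s) = int n \<and> snd (st_end \<Omega> s) = int n
      \<longleftrightarrow> fst s = n \<and> snd s < \<alpha> n" (is "?L \<longleftrightarrow> ?R") for s
  proof -
    obtain i t where s: "s = (i, t)" by (cases s)
    show ?thesis
    proof
      assume L: ?L
      then have "t < length (\<Omega> i)" "\<Omega> i ! t = StE" by (auto simp: s occ_def st_kind_def)
      then consider "t < \<alpha> i" | "i = k" "\<alpha> k < t" "t \<le> \<alpha> k + b" using nth_E by blast
      then show ?R
      proof cases
        case 1
        then show ?thesis using L walk_E[of t i] by (auto simp: s st_start_def)
      next
        case 2
        then show ?thesis using L walk_after_S[of t] k by (auto simp: s st_start_def)
      qed
    next
      assume R: ?R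
      have "t < length (\<Omega> i)" using R by (simp add: s \<Omega>)
      moreover have "\<Omega> i ! t = StE" using R calculation nth_E by (auto simp: s)
      ultimately show ?L using R walk_E[of t i] walk_E[of "Suc t" i] k
        by (auto simp: s occ_def st_kind_def st_start_def st_end_def)
    qed
  qed
  then show ?thesis by auto
qed

lemma card_E_N_steps:
  "card {s \<in> occ n \<Omega>. st_kind \<Omega> s \<in> {StE, StN}} = (\<Sum>i\<in>{1..n}. \<alpha> i) + b + 1"
proof -
  let ?P = "\<lambda>s. s \<in> {StE, StN}"
  have "{s \<in> occ n \<Omega>. st_kind \<Omega> s \<in> {StE, StN}}
      = (SIGMA i:{1..n}. {t. t < length (\<Omega> i) \<and> ?P (\<Omega> i ! t)})"
    by (auto simp: occ_def st_kind_def)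
  then have "card {s \<in> occ n \<Omega>. st_kind \<Omega> s \<in> {StE, StN}}
      = (\<Sum>i\<in>{1..n}. length (filter ?P (\<Omega> i)))"
    by (simp add: length_filter_conv_card)
  also have "\<dots> = (\<Sum>i\<in>{1..n}. \<alpha> i + (if i = k - 1 then 1 else 0) + (if i = k then b else 0))"
    using k by (intro sum.cong) (auto simp: \<Omega>)
  also have "\<dots> = (\<Sum>i\<in>{1..n}. \<alpha> i) + b + 1"
  proof -
    have "k - 1 \<in> {1..n}" "k \<in> {1..n}" using k by auto
    then show ?thesis by (simp add: sum.distrib)
  qed
  finally show ?thesis .
qed

end

section \<open>Neutralization and reflection\<close>

lemma Lambda_pos_props:
  assumes A: "A \<in> ASM n 1" and sign: "\<not> negative A" and L: "Lambda_pos n A = (N, E)"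
  shows "E = Epar n A" "0 \<le> E" "N \<in> ASM n 1" "neutral N" "cc n N = cc n A + E"
    "rstat N = rstat A" "inv n N = inv n A" "ell n N = ell n A" "0 \<le> cc n A"
proof -
  obtain f u p m q c where X: "one_neg n A f u p m q c" using ASM_one_neg[OF A] .
  interpret X: one_neg n A f u p m q c by (rule X)
  show E: "E = Epar n A" using L by (simp add: Lambda_pos_def Delta_def)
  have E_ge: "0 \<le> Epar n A" by (simp only: X.Epar_eq[OF sign])
  then show "0 \<le> E" using E by simp
  show cc_ge: "0 \<le> cc n A" by (simp only: X.cc_eq)
  have du: "X.dperm u = q" using X.f_u by (simp add: X.dperm_def)
  have "nat (cc n A + Epar n A) < card {x \<in> X.dperm ` {Suc u<..n}. X.dperm u < x}"
    using X.card_active[OF sign] by (simp only: du)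
  moreover have "X.dperm (Suc u) < X.dperm u" using X.dperm_Suc_u_less by (simp only: du)
  moreover have "Suc u \<le> n" using X.rows by simp
  ultimately obtain M f' m' c' where Y: "one_neg n M f' u (Suc u) m' (X.dperm u) c'"
    and dperm: "\<And>i. i \<in> {1..n} \<Longrightarrow> one_neg.dperm n f' u (Suc u) (X.dperm u) c' i = X.dperm i"
    and cc: "cc n M = int (nat (cc n A + Epar n A))"
    using neutral_exists[OF X.dperm_bij X.rows(1)] by blast
  interpret Y: one_neg n M f' u "Suc u" m' "X.dperm u" c' by (rule Y)
  have neutral_M: "neutral M" by (simp add: Y.neutral_iff)
  then have sign_M: "\<not> negative M" by (simp add: negative_def)
  have Epar_M: "Epar n M = 0" using neutral_M by (simp add: Epar_def positive_def)
  have cc_M: "cc n M = cc n A + E" using cc E cc_ge E_ge by simp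
  have delta: "delta n M = delta n A"
    by (intro ext) (simp add: X.delta_eq Y.delta_eq dperm)
  \<comment> \<open>Uniqueness for the \<open>THE\<close> in \<open>Lambda_pos\<close>: in a
    positive candidate the 1 of the lowest enclosed row already forces a nonzero charge, and a
    neutral candidate agrees with \<open>M\<close> in opening row, \<open>delta\<close> and
    \<open>cc\<close>.\<close>
  have "M' = M" if M': "M' \<in> ASM1pos n \<union> ASM1neu n" and D: "Delta n M' = (u, delta n A, cc n A + E, 0)" for M'
  proof -
    have ASM': "M' \<in> ASM n 1" using M' by (auto simp: ASM1pos_def ASM1neu_def)
    obtain g v r s t w where Z: "one_neg n M' g v r s t w" using ASM_one_neg[OF ASM'] .
    interpret Z: one_neg n M' g v r s t w by (rule Z)
    have v: "v = u" using D Z.open_row_eq by (simp add: Delta_def)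
    have "\<not> positive M'"
    proof
      assume pos: "positive M'"
      then have "\<not> negative M'" by (auto simp: positive_def negative_def)
      then have "card {i \<in> {v<..<r}. t < g i} = 0" using D Z.Epar_eq by (simp add: Delta_def)
      moreover have "r - 1 \<in> {i \<in> {v<..<r}. t < g i}" using pos Z.rows by (auto simp: Z.positive_iff)
      ultimately show False by auto
    qed
    then have "r = Suc u" using M' v Z.neutral_iff by (auto simp: ASM1pos_def ASM1neu_def)
    then have "one_neg n M' g u (Suc u) s t w" using Z v by simp
    then show "M' = M"
      using Y by (rule neutral_unique) (use D delta cc_M in \<open>simp_all add: Delta_def\<close>)
  qed
  moreover have "M \<in> ASM1pos n \<union> ASM1neu n" using Y.in_ASM neutral_M by (simp add: ASM1neu_def)
  moreover have "Delta n M = (u, delta n A, cc n A + E, 0)"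
    by (simp add: Delta_def Y.open_row_eq delta cc_M Epar_M)
  ultimately have "(THE M. M \<in> ASM1pos n \<union> ASM1neu n \<and> Delta n M = (u, delta n A, cc n A + E, 0)) = M"
    by (intro the_equality) blast+
  then have N: "N = M" using L E by (simp add: Lambda_pos_def Delta_def X.open_row_eq)
  show "N \<in> ASM n 1" "neutral N" "cc n N = cc n A + E"
    using Y.in_ASM neutral_M cc_M N by simp_all
  have high: "f i = f' i" if "i \<in> {1..u}" for i
  proof -
    have "X.dperm i = f i" using that by (simp add: X.dperm_def)
    moreover have "Y.dperm i = f' i" using that by (simp add: Y.dperm_def)
    ultimately show ?thesis using dperm[of i] that X.rows by simp
  qed
  show "rstat N = rstat A" using high[of 1] X.rows(1) by (simp add: N X.rstat_eq Y.rstat_eq)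
  have "(\<Sum>i\<in>{1..n}. int (Y.inv_dperm i)) = (\<Sum>i\<in>{1..n}. int (X.inv_dperm i))"
  proof (rule sum.cong)
    fix i assume i: "i \<in> {1..n}"
    have "{k \<in> {i<..n}. Y.dperm k < Y.dperm i} = {k \<in> {i<..n}. X.dperm k < X.dperm i}"
      using i by (auto simp: dperm)
    then show "int (Y.inv_dperm i) = int (X.inv_dperm i)" by (simp only: X.inv_dperm_def Y.inv_dperm_def)
  qed simp
  \<comment> \<open>The charge that vanishes in the neutral matrix reappears in its closing
    cell.\<close>
  then show "inv n N = inv n A"
    unfolding N X.inv_eq_dperm[OF sign] Y.inv_eq_dperm[OF sign_M] using Epar_M cc_M E by simp
  have "f ` {1..u} = f' ` {1..u}" using high by (rule image_cong[OF refl])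
  moreover have "Y.dperm (Suc u) = X.dperm (Suc u)" using dperm X.rows by simp
  ultimately show "ell n N = ell n A"
    by (simp only: N X.ell_eq_free_columns Y.ell_eq_free_columns du)
qed

section \<open>Vertical reflection\<close>

lemma bar_bar: "A \<in> ASM n 1 \<Longrightarrow> bar n (bar n A) = A"
proof (intro ext)
  fix i j assume "A \<in> ASM n 1"
  then have "\<not> (i \<in> {1..n} \<and> j \<in> {1..n}) \<Longrightarrow> A i j = 0" unfolding ASM_def is_asm_def by blast
  moreover have "n + 1 - (n + 1 - j) = j" "n + 1 - j \<in> {1..n}" if "j \<in> {1..n}" using that by auto
  ultimately show "bar n (bar n A) i j = A i j" unfolding bar_def by (simp only: if_True if_False split: if_splits) auto
qed

lemma bar_ASM: "A \<in> ASM n 1 \<Longrightarrow> bar n A \<in> ASM n 1"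
  by (metis ASM_one_neg one_neg.bar_one_neg one_neg.in_ASM)

lemma neutral_bar: "A \<in> ASM n 1 \<Longrightarrow> neutral (bar n A) \<longleftrightarrow> neutral A"
  by (metis ASM_one_neg one_neg.bar_one_neg one_neg.neutral_iff)

lemma positive_bar: "A \<in> ASM n 1 \<Longrightarrow> positive (bar n A) \<longleftrightarrow> negative A"
proof -
  assume "A \<in> ASM n 1"
  then obtain f u p m q c where X: "one_neg n A f u p m q c" by (rule ASM_one_neg)
  interpret one_neg n A f u p m q c by (rule X)
  have "p - 1 \<noteq> p" "f (p - 1) \<le> n" "q \<le> n" using rows cols c_le f_range[of "p - 1"] by (auto simp: Suc_le_eq)
  then show ?thesis
    unfolding one_neg.positive_iff[OF bar_one_neg] negative_iff by (auto simp: diff_less_mono2)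
qed

lemma rstat_bar:
  assumes "A \<in> ASM n 1"
  shows "int (rstat A) + int (rstat (bar n A)) = int n - 1"
proof -
  obtain f u p m q c where X: "one_neg n A f u p m q c" using ASM_one_neg[OF assms] .
  interpret one_neg n A f u p m q c by (rule X)
  have "f 1 \<in> {1..n}" "1 \<noteq> p" using f_range[of 1] rows by auto
  then show ?thesis unfolding rstat_eq one_neg.rstat_eq[OF bar_one_neg] by (auto simp: of_nat_diff)
qed

text \<open>In a neutral matrix the leading column is \<open>f p\<close>, which reflection turns
  into the closing column, so the two cells are mirror images. Row \<open>p\<close> lies only in the
  range of \<open>ell\<close>, where the strict bound at \<open>f p\<close> excludes it.\<close>

lemma cc_bar:
  assumes "A \<in> ASM n 1" "neutral A"
  shows "cc n (bar n A) = ell n A"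
proof -
  obtain f u p m q c where X: "one_neg n A f u p m q c" using ASM_one_neg[OF assms(1)] .
  interpret one_neg n A f u p m q c by (rule X)
  have p: "p = Suc u" using assms(2) neutral_iff by simp
  have l: "dperm (Suc u) = f p" using neutral_dperm[of n A f u m q c] X by (simp add: p)
  have "{i \<in> {p<..n}. n + 1 - q < n + 1 - (f(p := c)) i \<and> n + 1 - (f(p := c)) i < n + 1 - f p}
      = {i \<in> {u<..n}. f p < f i \<and> f i < q}"
  proof -
    have "n + 1 - q < n + 1 - (f(p := c)) i \<and> n + 1 - (f(p := c)) i < n + 1 - f p \<longleftrightarrow> f p < f i \<and> f i < q"
      if "i \<in> {p<..n}" for i
      using that f_range[of i] f_range[of p] rows cols c_le by auto
    moreover have "i \<in> {p<..n} \<or> i = p" if "i \<in> {u<..n}" for i using that p by auto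
    ultimately show ?thesis using rows by auto
  qed
  then show ?thesis unfolding ell_eq one_neg.cc_eq[OF bar_one_neg] l by simp
qed

text \<open>A column with a single 1 contributes 0; the opening column with 1, -1, 1 contributes -1
  + 1 - 1. Summed by rows, all of it comes from the -1, which has the 1 of row \<open>m\<close>
  below it.\<close>

lemma (in one_neg) sum_column_products:
  "(\<Sum>i\<in>{1..n}. \<Sum>j\<in>{1..n}. A i j * (\<Sum>k\<in>{i<..n}. A k j)) = -1"
proof -
  define w where "w i j = (\<Sum>k\<in>{i<..n}. A k j)" for i j
  have w: "w i j = int (card {k \<in> {i<..n}. f k = j}) + of_bool (i < p) * (of_bool (c = j) - of_bool (q = j))"
    if "i \<in> {1..n}" "j \<in> {1..n}" for i j
  proof -
    have "{i<..n} \<subseteq> {1..n}" "{j} \<subseteq> {1..n}" using that by auto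
    then show ?thesis using block_sum[of "{i<..n}" "{j}"] rows by (simp add: w_def)
  qed
  have f_q: "f k = q \<longleftrightarrow> k = m" if "k \<in> {u<..n}" for k
    using that f_eq_q[of k] rows by auto
  have w_f: "w i (f i) = 0" if i: "i \<in> {1..n}" for i
  proof (cases "i = u")
    case True
    have "{k \<in> {u<..n}. f k = q} = {m}" using rows f_q by auto
    then show ?thesis using w[OF i f_range[OF i]] True rows cols f_u by simp
  next
    case False
    have "{k \<in> {i<..n}. f k = f i} = {}"
    proof -
      have "f k \<noteq> f i" if "k \<in> {i<..n}" for k
        using that i False f_eq[of k i] f_eq_q[of k] f_eq_q[of i] f_m rows by auto
      then show ?thesis by blast
    qed
    moreover have "i < p \<longrightarrow> f i \<noteq> q" using f_eq_q[OF i] False rows by auto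
    ultimately show ?thesis using w[OF i f_range[OF i]] f_neq_c[OF i] by auto
  qed
  have w_c: "w p c = 0"
  proof -
    have "{k \<in> {p<..n}. f k = c} = {}" using c_notin_below by auto
    then show ?thesis using w[of p c] rows cols c_le by simp
  qed
  have w_q: "w p q = 1"
  proof -
    have "f k = q \<longleftrightarrow> k = m" if "k \<in> {p<..n}" for k using that f_q[of k] rows by auto
    then have "{k \<in> {p<..n}. f k = q} = {m}" using rows by auto
    then show ?thesis using w[of p q] rows cols c_le by simp
  qed
  have "(\<Sum>i\<in>{1..n}. \<Sum>j\<in>{1..n}. A i j * w i j) = (\<Sum>i\<in>{1..n}. if i = p then -1 else 0)"
  proof (rule sum.cong)
    fix i assume i: "i \<in> {1..n}"
    show "(\<Sum>j\<in>{1..n}. A i j * w i j) = (if i = p then -1 else 0)"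
      using row_sum[OF i order_refl, of "w i"] w_f[OF i] w_c w_q f_range[OF i] cols c_le by simp
  qed simp
  also have "\<dots> = -1" using rows by simp
  finally show ?thesis by (simp only: w_def)
qed

text \<open>For rows \<open>i < k\<close> the products over all pairs of columns sum to 1. The two
  inversion numbers together omit just the pairs in a common column, whose products sum to
  -1.\<close>

lemma inv_bar:
  assumes A: "A \<in> ASM n 1"
  shows "inv n A + inv n (bar n A) = (\<Sum>i\<in>{1..n}. int (n - i)) + 1"
proof -
  obtain f u p m q c where X: "one_neg n A f u p m q c" using ASM_one_neg[OF assms(1)] .
  interpret one_neg n A f u p m q c by (rule X)
  have row: "(\<Sum>j\<in>{1..n}. A i j) = 1" if "i \<in> {1..n}" for i
    using row_sum[OF that order_refl, of "\<lambda>_. 1"] f_range[OF that] cols c_le by simp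
  have "inv n (bar n A) = (\<Sum>i\<in>{1..n}. \<Sum>j\<in>{1..n}. \<Sum>k\<in>{i<..n}. \<Sum>l\<in>{j<..n}. A i j * A k l)"
    unfolding inv_def
  proof (rule sum.cong[OF refl])
    fix i assume i: "i \<in> {1..n}"
    show "(\<Sum>j\<in>{1..n}. \<Sum>k\<in>{i<..n}. \<Sum>l\<in>{1..<j}. bar n A i j * bar n A k l)
        = (\<Sum>j\<in>{1..n}. \<Sum>k\<in>{i<..n}. \<Sum>l\<in>{j<..n}. A i j * A k l)"
    proof (rule sum.reindex_bij_witness[of _ "\<lambda>j. n + 1 - j" "\<lambda>j. n + 1 - j"])
      fix j assume j: "j \<in> {1..n}"
      show "(\<Sum>k\<in>{i<..n}. \<Sum>l\<in>{n + 1 - j<..n}. A i (n + 1 - j) * A k l)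
          = (\<Sum>k\<in>{i<..n}. \<Sum>l\<in>{1..<j}. bar n A i j * bar n A k l)"
      proof (rule sum.cong[OF refl])
        fix k assume k: "k \<in> {i<..n}"
        show "(\<Sum>l\<in>{n + 1 - j<..n}. A i (n + 1 - j) * A k l) = (\<Sum>l\<in>{1..<j}. bar n A i j * bar n A k l)"
          by (rule sum.reindex_bij_witness[of _ "\<lambda>l. n + 1 - l" "\<lambda>l. n + 1 - l"])
            (use i j k in \<open>auto simp: bar_def\<close>)
      qed
    qed auto
  qed
  then have "inv n A + inv n (bar n A) = (\<Sum>i\<in>{1..n}. \<Sum>j\<in>{1..n}. \<Sum>k\<in>{i<..n}.
      (\<Sum>l\<in>{1..<j}. A i j * A k l) + (\<Sum>l\<in>{j<..n}. A i j * A k l))"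
    by (simp only: inv_def sum.distrib)
  also have "\<dots> = (\<Sum>i\<in>{1..n}. \<Sum>j\<in>{1..n}. \<Sum>k\<in>{i<..n}. A i j * (1 - A k j))"
  proof (intro sum.cong refl)
    fix i j k assume ijk: "i \<in> {1..n}" "j \<in> {1..n}" "k \<in> {i<..n}"
    have "{1..n} = insert j ({1..<j} \<union> {j<..n})" using ijk by auto
    then have "(\<Sum>l\<in>{1..n}. A k l) = A k j + ((\<Sum>l\<in>{1..<j}. A k l) + (\<Sum>l\<in>{j<..n}. A k l))"
      by (simp only:) (subst sum.insert; (subst sum.union_disjoint)?; auto)
    moreover have "(\<Sum>l\<in>{1..n}. A k l) = 1" using row[of k] ijk by simp
    ultimately have "(\<Sum>l\<in>{1..<j}. A k l) + (\<Sum>l\<in>{j<..n}. A k l) = 1 - A k j" by linarith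
    then show "(\<Sum>l\<in>{1..<j}. A i j * A k l) + (\<Sum>l\<in>{j<..n}. A i j * A k l) = A i j * (1 - A k j)"
      by (simp only: sum_distrib_left[symmetric] distrib_left[symmetric])
  qed
  also have "\<dots> = (\<Sum>i\<in>{1..n}. int (n - i) * (\<Sum>j\<in>{1..n}. A i j)
      - (\<Sum>j\<in>{1..n}. A i j * (\<Sum>k\<in>{i<..n}. A k j)))"
  proof (rule sum.cong[OF refl])
    fix i assume "i \<in> {1..n}"
    have "(\<Sum>k\<in>{i<..n}. A i j * (1 - A k j)) = int (n - i) * A i j - A i j * (\<Sum>k\<in>{i<..n}. A k j)" for j
      by (simp add: sum_distrib_left[symmetric] sum_subtractf right_diff_distrib)
    then show "(\<Sum>j\<in>{1..n}. \<Sum>k\<in>{i<..n}. A i j * (1 - A k j)) = int (n - i) * (\<Sum>j\<in>{1..n}. A i j)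
      - (\<Sum>j\<in>{1..n}. A i j * (\<Sum>k\<in>{i<..n}. A k j))"
      by (simp only: sum_subtractf sum_distrib_left)
  qed
  also have "\<dots> = (\<Sum>i\<in>{1..n}. int (n - i)) + 1"
    unfolding sum_subtractf sum_column_products using row by simp
  finally show ?thesis .
qed

text \<open>The last conclusion makes the exponent \<open>\<beta>\<close> of the path words
  nonnegative; for negative \<open>A\<close> the quantity is \<open>cc n (bar n A)\<close>.\<close>

lemma Lambda_props:
  assumes A: "A \<in> ASM n 1" and L: "Lambda n A = (N, E)"
  shows "N \<in> ASM n 1" "neutral N" "Epar n A = E" "rstat A = rstat N" "inv n A = inv n N"
    "Bpar n A = cc n N - ell n N - E" "Jpar n A = cc n N + ell n N + 1" "0 \<le> E + ell n N"
proof -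
  have "N \<in> ASM n 1 \<and> neutral N \<and> Epar n A = E \<and> rstat A = rstat N \<and> inv n A = inv n N \<and>
    Bpar n A = cc n N - ell n N - E \<and> Jpar n A = cc n N + ell n N + 1 \<and> 0 \<le> E + ell n N"
  proof (cases "negative A")
    case False
    then have "Lambda_pos n A = (N, E)" using L by (simp add: Lambda_def)
    note props = Lambda_pos_props[OF A False this]
    obtain f u p m q c where "one_neg n A f u p m q c" using ASM_one_neg[OF A] .
    then have "0 \<le> ell n A" using one_neg.ell_eq by fastforce
    then show ?thesis using props False by (simp add: Bpar_def Jpar_def Jbase_def)
  next
    case True
    define M E' where "M = fst (Lambda_pos n (bar n A))" and "E' = snd (Lambda_pos n (bar n A))"
    have L': "Lambda_pos n (bar n A) = (M, E')" by (simp add: M_def E'_def)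
    then have N: "N = bar n M" and E: "E = - E'" using L True by (simp_all add: Lambda_def)
    note A' = bar_ASM[OF A]
    have pos: "positive (bar n A)" using positive_bar[OF A] True by simp
    then have "\<not> negative (bar n A)" by (auto simp: positive_def negative_def)
    note props = Lambda_pos_props[OF A' this L']
    have M: "M \<in> ASM n 1" "neutral M" and N_ASM: "N \<in> ASM n 1" and N_neutral: "neutral N"
      using props bar_ASM[of M n] neutral_bar[of M n] N by auto
    have bar_N: "bar n N = M" using bar_bar[OF M(1)] N by simp
    have cc_N: "cc n N = ell n M" using cc_bar[OF M] N by simp
    have ell_N: "ell n N = cc n M" using cc_bar[OF N_ASM N_neutral] bar_N by simp
    have "\<not> positive A" "\<not> neutral A" using True by (auto simp: positive_def negative_def)
    then have "Epar n A = - Epar n (bar n A)" using pos by (simp add: Epar_def)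
    moreover have "rstat A = rstat N" using rstat_bar[OF A] rstat_bar[OF N_ASM] bar_N props(6) by simp
    moreover have "inv n A = inv n N" using inv_bar[OF A] inv_bar[OF N_ASM] bar_N props(7) by simp
    moreover have "Bpar n A = - (cc n (bar n A) - ell n (bar n A))" using True by (simp add: Bpar_def)
    moreover have "Jpar n A = Jbase n (bar n A)" using True by (simp add: Jpar_def)
    ultimately show ?thesis using props N_ASM N_neutral E cc_N ell_N by (simp add: Jbase_def)
  qed
  then show "N \<in> ASM n 1" "neutral N" "Epar n A = E" "rstat A = rstat N" "inv n A = inv n N"
    "Bpar n A = cc n N - ell n N - E" "Jpar n A = cc n N + ell n N + 1" "0 \<le> E + ell n N" by auto
qed

section \<open>Inversion table of a neutral matrix and the five identities\<close>

lemma git_props: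
  assumes "N \<in> ASM n 1" "neutral N"
  shows "2 \<le> git_k n N" "git_k n N \<le> n"
    "\<And>i. i \<in> {1..n} \<Longrightarrow> 0 \<le> git_a n N i"
    "git_a n N (git_k n N) = git_a n N (git_k n N - 1) + ell n N + 1"
    "int (rstat N) = git_a n N n"
    "inv n N = (\<Sum>i\<in>{1..n}. git_a n N i) + cc n N + 1"
    "0 \<le> cc n N"
proof -
  obtain f u p m q c where X: "one_neg n N f u p m q c" using ASM_one_neg[OF assms(1)] .
  interpret one_neg n N f u p m q c by (rule X)
  have p: "p = Suc u" using assms(2) neutral_iff by simp
  have k: "git_k n N = n + 1 - u" by (simp add: git_k_def open_row_eq)
  show "2 \<le> git_k n N" "git_k n N \<le> n" using k rows by auto
  \<comment> \<open>The correction in \<open>sw\<close> concerns only rows above \<open>p\<close>.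
    In a neutral matrix these are the rows up to \<open>u\<close>, where \<open>sw\<close> equals a
    count for \<open>dperm\<close>.\<close>
  have sw_ge: "0 \<le> sw i (f i)" if "i \<in> {1..n}" for i
  proof (cases "i \<le> u")
    case True
    then show ?thesis using inv_dperm_high[OF that True] by linarith
  next
    case False
    then have "\<not> i < p" using p by simp
    then show ?thesis by (simp add: sw_def)
  qed
  show "0 \<le> git_a n N i" if "i \<in> {1..n}" for i
    using that by (simp only: git_a_eq) (rule sw_ge, auto)
  show "int (rstat N) = git_a n N n" using git_a_eq[of n] rstat_eq_sw rows by simp
  show "0 \<le> cc n N" by (simp only: cc_eq)
  have "(\<Sum>i\<in>{1..n}. git_a n N i) = (\<Sum>i\<in>{1..n}. sw i (f i))"
    by (rule sum.reindex_bij_witness[of _ "\<lambda>i. n + 1 - i" "\<lambda>i. n + 1 - i"]) (use git_a_eq in auto)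
  then show "inv n N = (\<Sum>i\<in>{1..n}. git_a n N i) + cc n N + 1" by (simp only: inv_eq_sw)
  have l: "dperm (Suc u) = f p" using neutral_dperm[of n N f u m q c] X by (simp add: p)
  have "git_a n N (git_k n N) = sw u q"
  proof -
    have "n + 1 - u \<in> {1..n}" "n + 1 - (n + 1 - u) = u" using rows by auto
    then show ?thesis using git_a_eq[of "n + 1 - u"] f_u by (simp only: k)
  qed
  moreover have "git_a n N (git_k n N - 1) = sw p (f p)"
  proof -
    have "n - u \<in> {1..n}" "n + 1 - (n - u) = p" "git_k n N - 1 = n - u" using k rows p by auto
    then show ?thesis using git_a_eq[of "n - u"] by (simp only:)
  qed
  \<comment> \<open>Row \<open>p\<close> accounts for the 1; the remaining rows below
    \<open>u\<close> with a 1 left of \<open>q\<close> are split at column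
    \<open>f p\<close>.\<close>
  moreover have "sw u q = sw p (f p) + ell n N + 1"
  proof -
    have "{i \<in> {u<..n}. f i < q} = {i \<in> {p<..n}. f i < f p} \<union> insert p {i \<in> {u<..n}. f p < f i \<and> f i < q}"
    proof -
      have "f i \<noteq> f p" if "i \<in> {p<..n}" for i
        using that f_eq[of i p] f_m cols rows by (cases "i = m") auto
      moreover have "i \<in> {p<..n} \<or> i = p" if "i \<in> {u<..n}" for i using that p by auto
      ultimately show ?thesis using rows cols by (auto simp: neq_iff)
    qed
    moreover have "card ({i \<in> {p<..n}. f i < f p} \<union> insert p {i \<in> {u<..n}. f p < f i \<and> f i < q})
        = card {i \<in> {p<..n}. f i < f p} + Suc (card {i \<in> {u<..n}. f p < f i \<and> f i < q})"
      by (subst card_Un_disjoint) auto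
    ultimately show ?thesis using cols by (simp add: sw_def ell_eq l)
  qed
  ultimately show "git_a n N (git_k n N) = git_a n N (git_k n N - 1) + ell n N + 1" by simp
qed

theorem theorem4:
  fixes n :: nat and A N :: mat and E :: int
  assumes hA: "A \<in> ASM n 1"
    and hL: "Lambda n A = (N, E)"
  defines "k \<equiv> git_k n N"
    and "a \<equiv> git_a n N"
    and "b \<equiv> git_b n N"
    and "\<beta> \<equiv> git_beta n N E"
    and "\<Omega> \<equiv> Phi n N E"
  shows
    \<comment> \<open>(1)\<close>
    "rstat A = rstat N \<and> int (rstat N) = a n \<and>
     int (card {s \<in> occ n \<Omega>. st_kind \<Omega> s = StE \<and>
                  snd (st_start \<Omega> s) = int n \<and> snd (st_end \<Omega> s) = int n}) = a n \<and>
     (\<forall>s \<in> occ n \<Omega>. st_kind \<Omega> s = StE \<and>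
                  snd (st_start \<Omega> s) = int n \<and> snd (st_end \<Omega> s) = int n \<longrightarrow> fst s = n) \<and>
    \<comment> \<open>(2)\<close>
    inv n A = inv n N \<and> inv n N = (\<Sum>i\<in>{1..n}. a i) + b + 1 \<and>
     (\<Sum>i\<in>{1..n}. a i) + b + 1 = int (card {s \<in> occ n \<Omega>. st_kind \<Omega> s \<in> {StE, StN}}) \<and>
    \<comment> \<open>(3)\<close>
    Epar n A = E \<and> E = a (k - 1) + \<beta> + 1 - a k \<and>
     (\<exists>!s. s \<in> occ n \<Omega> \<and> st_kind \<Omega> s = StN) \<and>
     (\<exists>!s. s \<in> occ n \<Omega> \<and> st_kind \<Omega> s = StS) \<and>
     (\<forall>s1 s2. s1 \<in> occ n \<Omega> \<and> st_kind \<Omega> s1 = StN \<and> s2 \<in> occ n \<Omega> \<and> st_kind \<Omega> s2 = StS \<longrightarrow>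
        fst (st_end \<Omega> s1) - fst (st_start \<Omega> s2) = E \<and>
        snd (st_end \<Omega> s1) = int k \<and> snd (st_start \<Omega> s2) = int k) \<and>
    \<comment> \<open>(4)\<close>
    Bpar n A = Bpar n N - E \<and> Bpar n N - E = b - \<beta> \<and>
    \<comment> \<open>(5)\<close>
    Jpar n A = Jpar n N \<and> Jpar n N = a k - a (k - 1) + b \<and>
     snd (junction \<Omega> (k - 1)) = int k - 1 \<and> snd (junction \<Omega> k) = int k - 1 \<and>
     a k - a (k - 1) + b = \<bar>fst (junction \<Omega> k) - fst (junction \<Omega> (k - 1))\<bar>"
proof -
  note L = Lambda_props[OF hA hL]
  note G = git_props[OF L(1,2), folded k_def a_def]
  have b: "b = cc n N" and \<beta>: "\<beta> = E + ell n N" by (simp_all add: b_def git_b_def \<beta>_def git_beta_def)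
  define tail where "tail i = (if i = k - 1 then nat (int k - 2 - a i - \<beta>)
    else if i = k then nat (int k - 2 - a i - b) else nat (int i - 1 - a i))" for i
  have kk: "k - 1 \<noteq> k" using G(1) by auto
  interpret W: config_shape n k "\<lambda>i. nat (a i)" tail "nat b" "nat \<beta>" \<Omega>
  proof
    show "\<Omega> i = replicate (nat (a i)) StE
      @ (if i = k - 1 then replicate (nat \<beta>) StF @ [StN]
         else if i = k then [StS] @ replicate (nat b) StE else [])
      @ replicate (tail i) StF" for i
      using kk by (auto simp: \<Omega>_def Phi_def Let_def tail_def k_def a_def b_def \<beta>_def)
  qed (use G in auto)
  have n: "n \<in> {1..n}" and k1: "k - 1 \<in> {1..n}" and k: "k \<in> {1..n}" using G(1,2) by auto
  have nat_a: "int (nat (a i)) = a i" if "i \<in> {1..n}" for i using G(3)[OF that] by simp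
  have nat_b: "int (nat b) = b" and nat_\<beta>: "int (nat \<beta>) = \<beta>" using b \<beta> G(7) L(8) by simp_all
  have ell: "a k = a (k - 1) + ell n N + 1" by (rule G(4))
  have ell_ge: "0 \<le> ell n N"
  proof -
    obtain f u p m q c where "one_neg n N f u p m q c" using ASM_one_neg[OF L(1)] .
    then show ?thesis using one_neg.ell_eq by fastforce
  qed
  have neutral: "\<not> negative N" "Epar n N = 0"
    using L(2) by (auto simp: negative_def Epar_def positive_def)
  have B: "Bpar n N = cc n N - ell n N" and J: "Jpar n N = cc n N + ell n N + 1"
    using neutral by (simp_all add: Bpar_def Jpar_def Jbase_def)
  have top: "int (card {s \<in> occ n \<Omega>. st_kind \<Omega> s = StE \<and>
      snd (st_start \<Omega> s) = int n \<and> snd (st_end \<Omega> s) = int n}) = a n"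
    unfolding W.top_E_steps using nat_a[OF n] by simp
  have top_path: "\<forall>s \<in> occ n \<Omega>. st_kind \<Omega> s = StE \<and>
      snd (st_start \<Omega> s) = int n \<and> snd (st_end \<Omega> s) = int n \<longrightarrow> fst s = n"
  proof (intro ballI impI)
    fix s assume "s \<in> occ n \<Omega>" and "st_kind \<Omega> s = StE \<and>
      snd (st_start \<Omega> s) = int n \<and> snd (st_end \<Omega> s) = int n"
    then have "s \<in> {n} \<times> {..<nat (a n)}" unfolding W.top_E_steps[symmetric] by blast
    then show "fst s = n" by auto
  qed
  have total: "(\<Sum>i\<in>{1..n}. a i) + b + 1 = int (card {s \<in> occ n \<Omega>. st_kind \<Omega> s \<in> {StE, StN}})"
  proof -
    have "(\<Sum>i\<in>{1..n}. a i) = (\<Sum>i\<in>{1..n}. int (nat (a i)))" by (rule sum.cong) (use nat_a in auto)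
    then show ?thesis unfolding W.card_E_N_steps using nat_b by simp
  qed
  have E: "E = a (k - 1) + \<beta> + 1 - a k" using ell \<beta> by simp
  have ends: "fst (st_end \<Omega> s1) - fst (st_start \<Omega> s2) = E \<and>
        snd (st_end \<Omega> s1) = int k \<and> snd (st_start \<Omega> s2) = int k"
    if "s1 \<in> occ n \<Omega> \<and> st_kind \<Omega> s1 = StN \<and> s2 \<in> occ n \<Omega> \<and> st_kind \<Omega> s2 = StS" for s1 s2
  proof -
    have "s1 = (k - 1, nat (a (k - 1)) + nat \<beta>)" "s2 = (k, nat (a k))"
      using that W.occ_N W.occ_S by blast+
    then show ?thesis
      using W.st_end_N W.st_start_S E nat_a[OF k] nat_a[OF k1] nat_\<beta> by simp
  qed
  \<comment> \<open>Since \<open>ell n N\<close> and \<open>b\<close> are nonnegative, the junction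
    of path \<open>k\<close> lies to the right, which settles the absolute value.\<close>
  have dist: "a k - a (k - 1) + b = \<bar>fst (junction \<Omega> k) - fst (junction \<Omega> (k - 1))\<bar>"
    using W.junction_k W.junction_pred nat_a[OF k] nat_a[OF k1] nat_b ell ell_ge b G(7) by simp
  have "snd (junction \<Omega> (k - 1)) = int k - 1" "snd (junction \<Omega> k) = int k - 1"
    using W.junction_k W.junction_pred by simp_all
  moreover have "\<exists>!s. s \<in> occ n \<Omega> \<and> st_kind \<Omega> s = StN" "\<exists>!s. s \<in> occ n \<Omega> \<and> st_kind \<Omega> s = StS"
    unfolding W.occ_N W.occ_S by blast+
  moreover have "Bpar n A = Bpar n N - E" "Bpar n N - E = b - \<beta>" "Jpar n A = Jpar n N"
      "Jpar n N = a k - a (k - 1) + b" "inv n N = (\<Sum>i\<in>{1..n}. a i) + b + 1"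
    using L(6,7) B J b \<beta> ell G(6) by simp_all
  ultimately show ?thesis
    using L(3,4,5) G(5) top top_path total E ends dist by blast
qed

end
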